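(* Let $n,m,k,l$ be nonnegative integers with $k+l\le m$, let $\alpha,\beta>-1$ be real, let $r_0,\ldots,r_n\in\mathbb{R}$, and let $\omega_0,\ldots,\omega_n>0$. Put $$\omega(t)=\sum_{i=0}^n\omega_i B^n_i(t),\qquad R_n(t)=\frac{\sum_{i=0}^n\omega_i r_i B^n_i(t)}{\omega(t)}\qquad(0\le t\le 1).$$ Among all real polynomials $P_m$ of degree at most $m$ satisfying the constraints $$P_m^{(i)}(0)=R_n^{(i)}(0)\quad(i=0,1,\ldots,k-1),\qquad P_m^{(j)}(1)=R_n^{(j)}(1)\quad(j=0,1,\ldots,l-1),$$ the polynomial $P_m(t)=\sum_{i=0}^m p_iB^m_i(t)$ which minimises $$\int_0^1(1-t)^\alpha t^\beta\,\bigl(R_n(t)-P_m(t)\bigr)^2\,dt$$ has the coefficients $p_0,p_1,\ldots,p_m$ given by $$p_i=\frac{(m-i)!}{m!}\varrho_{i0}-\sum_{j=0}^{i-1}(-1)^{i+j}\binom{i}{j}p_j\qquad(i=0,1,\ldots,k-1),$$ $$p_{m-i}=(-1)^i\frac{(m-i)!}{m!}\varrho_{i1}-\sum_{j=1}^{i}(-1)^j\binom{i}{j}p_{m-i+j}\qquad(i=0,1,\ldots,l-1),$$ $$p_i=\sum_{h=0}^n\binom{n}{h}\omega_h r_h\sum_{j=k}^{m-l}\binom{m}{j}\binom{n+m}{j+h}^{-1}c_{ij}\,I_{j+h}-\Bigl(\sum_{j=0}^{k-1}+\sum_{j=m-l+1}^{m}\Bigr)p_jK_{ij}\qquad(i=k,k+1,\ldots,m-l).$$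 Here $c_{ij}$ $(k\le i,j\le m-l)$ are the Bernstein coefficients of the constrained dual Bernstein polynomials (defined in the context). The numbers $\varrho_{i0}$ and $\varrho_{i1}$ are defined recursively for $i=0,1,\ldots$ by $$\varrho_{i0}=\frac{n!}{\omega_0}\Bigl[\frac{1}{(n-i)!}\Delta^i(\omega_0r_0)-\sum_{j=0}^{i-1}\binom{i}{j}\frac{\Delta^{i-j}\omega_0}{(n-i+j)!}\,\varrho_{j0}\Bigr],$$ $$\varrho_{i1}=\frac{n!}{\omega_n}\Bigl[\frac{1}{(n-i)!}\Delta^i(\omega_{n-i}r_{n-i})-\sum_{j=0}^{i-1}\binom{i}{j}\frac{\Delta^{i-j}\omega_{n-i+j}}{(n-i+j)!}\,\varrho_{j1}\Bigr].$$ Furthermore, $$I_h=\int_0^1\frac{(1-t)^\alpha t^\beta B^{n+m}_h(t)}{\omega(t)}\,dt,$$ and, for $k\le i\le m-l$ and $j\in\{0,\ldots,k-1\}\cup\{m-l+1,\ldots,m\}$, $$K_{ij}=\binom{m}{j}\binom{m}{i}^{-1}\frac{(-1)^{i-k}(k-j)_{m-k-l+1}}{(i-j)\,(i-k)!\,(m-l-i)!}\cdot\frac{(\alpha+l+1)_{m-j}\,(\beta+k+1)_j}{(\alpha+l+1)_{m-i}\,(\beta+k+1)_i}.$$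
   Context: Bernstein polynomials: $B^N_i(t)=\binom{N}{i}t^i(1-t)^{N-i}$ for $0\le i\le N$. Pochhammer symbol: $(a)_p=\prod_{j=0}^{p-1}(a+j)$ for integers $p\ge0$ (so $(a)_0=1$). Forward differences: $\Delta^0c_h=c_h$ and $\Delta^jc_h=\Delta^{j-1}c_{h+1}-\Delta^{j-1}c_h$ for $j\ge1$, applied to the sequences $(\omega_h)_h$ and $(\omega_hr_h)_h$; thus $\Delta^i(\omega_0r_0)$ is the $i$-th difference of the sequence $(\omega_hr_h)_h$ at $h=0$, and $\Delta^i(\omega_{n-i}r_{n-i})$ is its $i$-th difference at $h=n-i$. Terms of the form $\Delta^{p}(\cdot)/(n-p)!$ with $p>n$ are read as $0$. Empty sums are $0$. Inner product: $\langle f,g\rangle=\int_0^1(1-t)^\alpha t^\beta f(t)g(t)\,dt$. Constrained space: $\Pi_m^{(k,l)}$ is the space of real polynomials $P$ of degree at most $m$ with $P^{(i)}(0)=0$ for $0\le i\le k-1$ and $P^{(j)}(1)=0$ for $0\le j\le l-1$; it has basis $B^m_k,B^m_{k+1},\ldots,B^m_{m-l}$. Constrained dual Bernstein polynomials: $D_k^{(m,k,l)},\ldots,D_{m-l}^{(m,k,l)}$ (depending on $\alpha,\beta$) form the unique basis of $\Pi_m^{(k,l)}$ with $\langle D_i^{(m,k,l)},B^m_j\rangle=\delta_{ij}$ for $i,j=k,\ldots,m-l$. The numbers $c_{ij}=c_{ij}(m,k,l,\alpha,\beta)$ are defined by $D_i^{(m,k,l)}=\sum_{j=k}^{m-l}c_{ij}B^m_j$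 for $k\le i\le m-l$. *)

theory Defs
  imports "HOL-Analysis.Analysis" "HOL-Computational_Algebra.Polynomial"
begin

definition weight_fun :: "nat \<Rightarrow> (nat \<Rightarrow> real) \<Rightarrow> real \<Rightarrow> real" where
  "weight_fun n \<omega> t = (\<Sum>i\<le>n. \<omega> i * Bernstein n i t)"

(* The formula is taken on all of the real line.  If \<omega> i > 0 for i \<le> n, the denominator is
   positive on a neighbourhood of [0,1], so the iterated (two-sided) derivatives deriv at 0 and 1
   are those of the rational function. *)
definition rational_bezier :: "nat \<Rightarrow> (nat \<Rightarrow> real) \<Rightarrow> (nat \<Rightarrow> real) \<Rightarrow> real \<Rightarrow> real" where
  "rational_bezier n \<omega> r t = (\<Sum>i\<le>n. \<omega> i * r i * Bernstein n i t) / weight_fun n \<omega> t"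

definition jacobi_inner :: "real \<Rightarrow> real \<Rightarrow> (real \<Rightarrow> real) \<Rightarrow> (real \<Rightarrow> real) \<Rightarrow> real" where
  "jacobi_inner \<alpha> \<beta> f g = integral {0..1} (\<lambda>t. (1 - t) powr \<alpha> * t powr \<beta> * f t * g t)"

definition constrained_space :: "nat \<Rightarrow> nat \<Rightarrow> nat \<Rightarrow> real poly set" where
  "constrained_space m k l = {P. degree P \<le> m \<and>
     (\<forall>i<k. poly ((pderiv ^^ i) P) 0 = 0) \<and> (\<forall>j<l. poly ((pderiv ^^ j) P) 1 = 0)}"

definition is_constrained_dual_basis ::
  "real \<Rightarrow> real \<Rightarrow> nat \<Rightarrow> nat \<Rightarrow> nat \<Rightarrow> (nat \<Rightarrow> real poly) \<Rightarrow> bool" where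
  "is_constrained_dual_basis \<alpha> \<beta> m k l D \<longleftrightarrow>
     inj_on D {k..m-l} \<and>
     \<not> module.dependent smult (D ` {k..m-l}) \<and>
     module.span smult (D ` {k..m-l}) = constrained_space m k l \<and>
     (\<forall>i\<in>{k..m-l}. \<forall>j\<in>{k..m-l}.
        jacobi_inner \<alpha> \<beta> (poly (D i)) (Bernstein m j) = (if i = j then 1 else 0))"

(* For k + l \<le> m and \<alpha>, \<beta> > -1 the choice is determined at all indices in {k..m-l}. *)
definition constrained_dual_bernstein ::
  "real \<Rightarrow> real \<Rightarrow> nat \<Rightarrow> nat \<Rightarrow> nat \<Rightarrow> nat \<Rightarrow> real poly" where
  "constrained_dual_bernstein \<alpha> \<beta> m k l = (SOME D. is_constrained_dual_basis \<alpha> \<beta> m k l D)"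

(* Likewise determined for all indices i, j in {k..m-l}. *)
definition dual_coeff :: "real \<Rightarrow> real \<Rightarrow> nat \<Rightarrow> nat \<Rightarrow> nat \<Rightarrow> nat \<Rightarrow> nat \<Rightarrow> real" where
  "dual_coeff \<alpha> \<beta> m k l = (SOME c. \<forall>i\<in>{k..m-l}. \<forall>t.
     poly (constrained_dual_bernstein \<alpha> \<beta> m k l i) t = (\<Sum>j=k..m-l. c i j * Bernstein m j t))"

fun fwd_diff :: "nat \<Rightarrow> (nat \<Rightarrow> real) \<Rightarrow> nat \<Rightarrow> real" where
  "fwd_diff 0 c h = c h"
| "fwd_diff (Suc j) c h = fwd_diff j c (Suc h) - fwd_diff j c h"

(* The quotient of the p-th difference at h by (n-p)!, read as 0 for p > n; this also disposes of
   the indices h = n - p that would be negative. *)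
definition diff_quot :: "nat \<Rightarrow> nat \<Rightarrow> (nat \<Rightarrow> real) \<Rightarrow> nat \<Rightarrow> real" where
  "diff_quot n p c h = (if p \<le> n then fwd_diff p c h / fact (n - p) else 0)"

fun rho0 :: "nat \<Rightarrow> (nat \<Rightarrow> real) \<Rightarrow> (nat \<Rightarrow> real) \<Rightarrow> nat \<Rightarrow> real" where
  "rho0 n \<omega> r i = fact n / \<omega> 0 *
     (diff_quot n i (\<lambda>h. \<omega> h * r h) 0
      - (\<Sum>j<i. real (i choose j) * diff_quot n (i - j) \<omega> 0 * rho0 n \<omega> r j))"

(* With p = i - j, the index n - i + j at which the difference of \<omega> is taken is n - p. *)
fun rho1 :: "nat \<Rightarrow> (nat \<Rightarrow> real) \<Rightarrow> (nat \<Rightarrow> real) \<Rightarrow> nat \<Rightarrow> real" where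
  "rho1 n \<omega> r i = fact n / \<omega> n *
     (diff_quot n i (\<lambda>h. \<omega> h * r h) (n - i)
      - (\<Sum>j<i. real (i choose j) * diff_quot n (i - j) \<omega> (n - (i - j)) * rho1 n \<omega> r j))"

declare rho0.simps [simp del] rho1.simps [simp del]

definition I_int :: "real \<Rightarrow> real \<Rightarrow> nat \<Rightarrow> nat \<Rightarrow> (nat \<Rightarrow> real) \<Rightarrow> nat \<Rightarrow> real" where
  "I_int \<alpha> \<beta> n m \<omega> h =
     integral {0..1} (\<lambda>t. (1 - t) powr \<alpha> * t powr \<beta> * Bernstein (n + m) h t / weight_fun n \<omega> t)"

definition K_coeff :: "real \<Rightarrow> real \<Rightarrow> nat \<Rightarrow> nat \<Rightarrow> nat \<Rightarrow> nat \<Rightarrow> nat \<Rightarrow> real" where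
  "K_coeff \<alpha> \<beta> m k l i j =
     real (m choose j) / real (m choose i)
     * ((-1) ^ (i - k) * pochhammer (real k - real j) (m - k - l + 1)
        / ((real i - real j) * fact (i - k) * fact (m - l - i)))
     * (pochhammer (\<alpha> + real l + 1) (m - j) * pochhammer (\<beta> + real k + 1) j
        / (pochhammer (\<alpha> + real l + 1) (m - i) * pochhammer (\<beta> + real k + 1) i))"

definition admissible :: "nat \<Rightarrow> nat \<Rightarrow> nat \<Rightarrow> (real \<Rightarrow> real) \<Rightarrow> real poly \<Rightarrow> bool" where
  "admissible m k l R P \<longleftrightarrow> degree P \<le> m \<and>
     (\<forall>i<k. poly ((pderiv ^^ i) P) 0 = (deriv ^^ i) R 0) \<and>
     (\<forall>j<l. poly ((pderiv ^^ j) P) 1 = (deriv ^^ j) R 1)"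

definition sq_error :: "real \<Rightarrow> real \<Rightarrow> (real \<Rightarrow> real) \<Rightarrow> real poly \<Rightarrow> real" where
  "sq_error \<alpha> \<beta> R P = integral {0..1} (\<lambda>t. (1 - t) powr \<alpha> * t powr \<beta> * (R t - poly P t)\<^sup>2)"

definition is_best_approx ::
  "real \<Rightarrow> real \<Rightarrow> nat \<Rightarrow> nat \<Rightarrow> nat \<Rightarrow> (real \<Rightarrow> real) \<Rightarrow> real poly \<Rightarrow> bool" where
  "is_best_approx \<alpha> \<beta> m k l R P \<longleftrightarrow> admissible m k l R P \<and>
     (\<forall>Q. admissible m k l R Q \<longrightarrow> sq_error \<alpha> \<beta> R P \<le> sq_error \<alpha> \<beta> R Q)"

end

theory Submission
  imports Defs
begin

text \<open>
  The difference of two admissible polynomials lies in the constrained space, and adding an element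
  of this space to an admissible polynomial keeps it admissible.  So the problem is the orthogonal
  projection onto a translate of a finite-dimensional space: an admissible \<open>P\<close> is the best
  approximation of \<open>R\<close> iff \<open>R - P\<close> is orthogonal to the constrained space, and there is exactly one
  such \<open>P\<close> (\<open>is_best_approx_iff_orthogonal\<close>, \<open>is_best_approx_ex1\<close>).

  The coefficients next to the two ends are determined by the constraints.  The derivative of order
  \<open>i\<close> of a Bernstein form at an endpoint is a multiple of the \<open>i\<close>-th forward difference of its
  coefficients there, and that difference contains the coefficient number \<open>i\<close>, counted from the
  endpoint, with factor \<open>1\<close> or \<open>-1\<close>; this gives the two recursions for \<open>p\<close>.  The numbers \<open>rho0\<close> and
  \<open>rho1\<close> are the derivatives of the rational function: apply the Leibniz rule to the product of the
  denominator and the function and solve for the term of highest order (\<open>rho0_eq_deriv\<close>,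
  \<open>rho1_eq_deriv\<close>).

  For the remaining coefficients pair the residual with the dual polynomial \<open>D i\<close>.  Orthogonality
  gives \<open>\<langle>R, D i\<rangle> = p i + (\<Sum>j. p j * \<langle>B j, D i\<rangle>)\<close>, where \<open>B j\<close> are the Bernstein polynomials of degree
  \<open>m\<close> and \<open>j\<close> runs over the indices outside \<open>{k..m-l}\<close>.  Here \<open>\<langle>R, D i\<rangle>\<close> expands into the integrals
  \<open>I_int\<close> because a product of two Bernstein polynomials is a multiple of a third.  That \<open>\<langle>B j, D i\<rangle>\<close> is
  \<open>K_coeff\<close> means that \<open>B j - (\<Sum>i. K_coeff i j * B i)\<close>, with \<open>i\<close> in \<open>{k..m-l}\<close>, is orthogonal to all
  \<open>B s\<close> with \<open>s\<close> in \<open>{k..m-l}\<close>.  Up to normalising factors that depend on \<open>x\<close> or on \<open>s\<close> only,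
  \<open>\<langle>B x, B s\<rangle>\<close> is the value at \<open>x\<close> of a polynomial of degree at most \<open>m - k - l\<close>, and the orthogonality is
  Lagrange interpolation of this polynomial at the \<open>m - k - l + 1\<close> nodes \<open>k, ..., m - l\<close>, evaluated at
  the point \<open>j\<close> (\<open>jacobi_inner_Bernstein_outer\<close>).
\<close>

section \<open>Bernstein forms and their derivatives at the endpoints\<close>

definition bernstein_form :: "nat \<Rightarrow> (nat \<Rightarrow> real) \<Rightarrow> real poly" where
  "bernstein_form n c =
     (\<Sum>i\<le>n. smult (c i * real (n choose i)) (monom 1 i * [:1, -1:] ^ (n - i)))"

lemma poly_bernstein_form: "poly (bernstein_form n c) t = (\<Sum>i\<le>n. c i * Bernstein n i t)"
  by (simp add: bernstein_form_def poly_sum Bernstein_def poly_monom algebra_simps)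

lemma degree_bernstein_form: "degree (bernstein_form n c) \<le> n"
  unfolding bernstein_form_def
proof (rule degree_sum_le)
  fix i assume "i \<in> {..n}"
  have "degree (monom 1 i * [:1, -1:] ^ (n - i) :: real poly)
      \<le> degree (monom 1 i :: real poly) + degree ([:1, -1:] ^ (n - i) :: real poly)"
    by (rule degree_mult_le)
  also have "\<dots> \<le> i + (n - i)"
    by (intro add_mono degree_monom_le order.trans[OF degree_power_le]) simp
  finally show "degree (smult (c i * real (n choose i)) (monom 1 i * [:1, -1:] ^ (n - i))) \<le> n"
    using \<open>i \<in> {..n}\<close> by (intro order.trans[OF degree_smult_le]) simp
qed simp

lemma bernstein_form_diff:
  "bernstein_form n (\<lambda>i. c i - d i) = bernstein_form n c - bernstein_form n d"
  by (simp add: bernstein_form_def sum_subtractf smult_diff_left left_diff_distrib)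

lemma Bernstein_Suc_Suc:
  "Bernstein (Suc n) (Suc i) t = t * Bernstein n i t + (1 - t) * Bernstein n (Suc i) t"
proof (cases "i < n")
  case True
  then have "(1 - t) ^ (n - i) = (1 - t) * (1 - t) ^ (n - Suc i)"
    by (metis Suc_diff_Suc power_Suc)
  then show ?thesis unfolding Bernstein_def diff_Suc_Suc binomial_Suc_Suc power_Suc
    by (simp only: of_nat_add) (simp add: algebra_simps)
next
  case False
  then have "n choose Suc i = 0" by simp
  then show ?thesis by (simp add: Bernstein_def algebra_simps)
qed

lemma de_Casteljau:
  "bernstein_form (Suc n) c =
     [:1, -1:] * bernstein_form n c + [:0, 1:] * bernstein_form n (\<lambda>i. c (Suc i))"
proof -
  have "poly (bernstein_form (Suc n) c) t
      = poly ([:1, -1:] * bernstein_form n c + [:0, 1:] * bernstein_form n (\<lambda>i. c (Suc i))) t" for t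
  proof -
    have "(\<Sum>i\<le>n. c i * Bernstein n i t) = (\<Sum>i\<le>Suc n. c i * Bernstein n i t)"
      by (simp add: Bernstein_def)
    also have "\<dots> = c 0 * Bernstein n 0 t + (\<Sum>i\<le>n. c (Suc i) * Bernstein n (Suc i) t)"
      by (rule sum.atMost_Suc_shift)
    finally have 1: "(\<Sum>i\<le>n. c i * Bernstein n i t)
      = c 0 * Bernstein n 0 t + (\<Sum>i\<le>n. c (Suc i) * Bernstein n (Suc i) t)" .
    have "(\<Sum>i\<le>Suc n. c i * Bernstein (Suc n) i t)
      = c 0 * Bernstein (Suc n) 0 t + (\<Sum>i\<le>n. c (Suc i) * Bernstein (Suc n) (Suc i) t)"
      by (rule sum.atMost_Suc_shift)
    also have "\<dots> = (1 - t) * (\<Sum>i\<le>n. c i * Bernstein n i t) + t * (\<Sum>i\<le>n. c (Suc i) * Bernstein n i t)"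
      unfolding 1 Bernstein_Suc_Suc
      by (simp add: Bernstein_def[of _ 0] sum.distrib sum_subtractf sum_distrib_left algebra_simps)
    finally show ?thesis by (simp add: poly_bernstein_form algebra_simps)
  qed
  then show ?thesis by (auto simp flip: poly_eq_poly_eq_iff)
qed

text \<open>Differentiating the de Casteljau recursion turns the statement for one degree into that for the
  next.\<close>
lemma pderiv_bernstein_form:
  "pderiv (bernstein_form (Suc n) c) = smult (real (Suc n)) (bernstein_form n (\<lambda>i. c (Suc i) - c i))"
proof (induction n arbitrary: c)
  case 0
  show ?case by (simp add: bernstein_form_def monom_altdef pderiv_add pderiv_smult pderiv_pCons)
next
  case (Suc n)
  let ?s = "\<lambda>c i. c (Suc i) :: real"
  \<comment> \<open>The two pieces of degree \<^term>\<open>n\<close> recombine by the de Casteljau recursion for the differences.\<close>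
  have "pderiv (bernstein_form (Suc (Suc n)) c)
     = bernstein_form (Suc n) (?s c) - bernstein_form (Suc n) c
       + smult (real (Suc n)) ([:1, -1:] * bernstein_form n (\<lambda>i. c (Suc i) - c i)
            + [:0, 1:] * bernstein_form n (\<lambda>i. ?s c (Suc i) - ?s c i))"
    unfolding de_Casteljau[of "Suc n"] pderiv_add pderiv_mult Suc.IH
    by (simp add: pderiv_pCons algebra_simps smult_add_right smult_diff_right)
  also have "[:1, -1:] * bernstein_form n (\<lambda>i. c (Suc i) - c i)
            + [:0, 1:] * bernstein_form n (\<lambda>i. ?s c (Suc i) - ?s c i)
       = bernstein_form (Suc n) (\<lambda>i. c (Suc i) - c i)"
    by (simp only: de_Casteljau)
  also have "bernstein_form (Suc n) (?s c) - bernstein_form (Suc n) c = bernstein_form (Suc n) (\<lambda>i. c (Suc i) - c i)"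
    by (rule bernstein_form_diff[symmetric])
  also have "P + smult (real (Suc n)) P = smult (real (Suc (Suc n))) P" for P
    by (rule poly_eqI) (simp add: algebra_simps)
  finally show ?case .
qed

lemma fwd_diff_Suc: "fwd_diff (Suc i) c = (\<lambda>h. fwd_diff i c (Suc h) - fwd_diff i c h)"
  by auto

lemma higher_pderiv_bernstein_form:
  "i \<le> n \<Longrightarrow> (pderiv ^^ i) (bernstein_form n c)
     = smult (fact n / fact (n - i)) (bernstein_form (n - i) (fwd_diff i c))"
proof (induction i)
  case 0
  show ?case by (simp add: eta_contract_eq)
next
  case (Suc i)
  then have eq: "n - i = Suc (n - Suc i)" by simp
  have "(pderiv ^^ Suc i) (bernstein_form n c)
     = smult (fact n / fact (n - i)) (pderiv (bernstein_form (n - i) (fwd_diff i c)))"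
    using Suc by (simp add: pderiv_smult)
  also have "\<dots> = smult (fact n / fact (n - i) * real (n - i)) (bernstein_form (n - Suc i) (fwd_diff (Suc i) c))"
    unfolding eq pderiv_bernstein_form by (simp add: fwd_diff_Suc)
  also have "fact n / fact (n - i) * real (n - i) = fact n / (fact (n - Suc i) :: real)"
    unfolding eq fact_Suc by (simp del: of_nat_Suc)
  finally show ?case .
qed

lemma higher_pderiv_bernstein_form_eq_0:
  assumes "n < i"
  shows "(pderiv ^^ i) (bernstein_form n c) = 0"
proof -
  have "pderiv ((pderiv ^^ n) (bernstein_form n c)) = 0"
    using degree_bernstein_form[of 0 "fwd_diff n c"]
    by (simp add: higher_pderiv_bernstein_form pderiv_eq_0_iff pderiv_smult)
  then have "(pderiv ^^ (d + Suc n)) (bernstein_form n c) = 0" for d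
    by (induction d) simp_all
  from this[of "i - Suc n"] show ?thesis using assms by simp
qed

text \<open>At an endpoint all Bernstein polynomials but one vanish, so the forms of the previous lemmas take
  the value of their first or last coefficient.  The convention in \<^const>\<open>diff_quot\<close> covers the orders
  above \<^term>\<open>n\<close>.\<close>
lemma higher_pderiv_bernstein_form_at_0:
  "poly ((pderiv ^^ i) (bernstein_form n c)) 0 = fact n * diff_quot n i c 0"
proof (cases "i \<le> n")
  case True
  have "poly (bernstein_form N d) 0 = d 0" for N d
    by (induction N arbitrary: d) (simp_all add: de_Casteljau, simp add: bernstein_form_def)
  with True show ?thesis by (simp add: higher_pderiv_bernstein_form diff_quot_def)
qed (simp add: higher_pderiv_bernstein_form_eq_0 diff_quot_def)

lemma higher_pderiv_bernstein_form_at_1: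
  "poly ((pderiv ^^ i) (bernstein_form n c)) 1 = fact n * diff_quot n i c (n - i)"
proof (cases "i \<le> n")
  case True
  have "poly (bernstein_form N d) 1 = d N" for N d
    by (induction N arbitrary: d) (simp_all add: de_Casteljau, simp add: bernstein_form_def)
  with True show ?thesis by (simp add: higher_pderiv_bernstein_form diff_quot_def)
qed (simp add: higher_pderiv_bernstein_form_eq_0 diff_quot_def)

text \<open>Pascal's rule in summed form; it drives both the expansion of forward differences and the Leibniz
  rule.\<close>
lemma sum_binomial_Suc:
  fixes f :: "nat \<Rightarrow> real"
  shows "(\<Sum>j\<le>Suc i. real (Suc i choose j) * f j)
    = (\<Sum>j\<le>i. real (i choose j) * f (Suc j)) + (\<Sum>j\<le>i. real (i choose j) * f j)"
proof -
  have "(\<Sum>j\<le>i. real (i choose j) * f j) = (\<Sum>j\<le>Suc i. real (i choose j) * f j)"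
    by simp
  also have "\<dots> = f 0 + (\<Sum>j\<le>i. real (i choose Suc j) * f (Suc j))"
    by (subst sum.atMost_Suc_shift) simp
  finally show ?thesis
    by (subst sum.atMost_Suc_shift) (simp add: sum.distrib algebra_simps)
qed

lemma fwd_diff_eq_sum:
  "fwd_diff i c h = (\<Sum>j\<le>i. (-1) ^ (i + j) * real (i choose j) * c (h + j))"
proof (induction i arbitrary: h)
  case (Suc i)
  have "(\<Sum>j\<le>Suc i. (-1) ^ (Suc i + j) * real (Suc i choose j) * c (h + j))
      = (\<Sum>j\<le>Suc i. real (Suc i choose j) * ((-1) ^ (Suc i + j) * c (h + j)))"
    by (simp only: mult_ac)
  also have "\<dots> = fwd_diff i c (Suc h) - fwd_diff i c h"
    unfolding sum_binomial_Suc Suc.IH by (simp add: mult_ac sum_negf)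
  finally show ?case by simp
qed simp

text \<open>Reversing the coefficient sequence exchanges the roles of the two endpoints, so that everything
  about the differences at the upper end follows from the lower end.\<close>
lemma fwd_diff_reverse:
  assumes "i \<le> m"
  shows "fwd_diff i c (m - i) = (-1) ^ i * fwd_diff i (\<lambda>j. c (m - j)) 0"
proof -
  have "fwd_diff i c (m - i) = (\<Sum>j\<le>i. (-1) ^ (i + j) * real (i choose j) * c (m - i + j))"
    by (rule fwd_diff_eq_sum)
  also have "\<dots> = (\<Sum>j\<le>i. (-1) ^ (i + (i - j)) * real (i choose (i - j)) * c (m - i + (i - j)))"
    by (rule sum.reindex_bij_witness[of _ "\<lambda>j. i - j" "\<lambda>j. i - j"]) auto
  also have "\<dots> = (\<Sum>j\<le>i. (-1) ^ i * ((-1) ^ (i + j) * real (i choose j) * c (m - (0 + j))))"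
  proof (rule sum.cong[OF refl])
    fix j assume "j \<in> {..i}"
    then have j: "j \<le> i" by simp
    have "(-1) ^ (i + (i - j)) = ((-1) ^ i * (-1) ^ (i + j) :: real)"
      unfolding power_add[symmetric] by (rule minus_one_power_iff[THEN trans]) (use j in \<open>auto simp: minus_one_power_iff\<close>)
    moreover have "m - i + (i - j) = m - j" using j assms by simp
    ultimately show "(-1) ^ (i + (i - j)) * real (i choose (i - j)) * c (m - i + (i - j))
       = (-1) ^ i * ((-1) ^ (i + j) * real (i choose j) * c (m - (0 + j)))"
      using j by (simp add: binomial_symmetric[symmetric])
  qed
  also have "\<dots> = (-1) ^ i * fwd_diff i (\<lambda>j. c (m - j)) 0"
    by (simp add: fwd_diff_eq_sum sum_distrib_left)
  finally show ?thesis .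
qed

lemma fwd_diff_0_split:
  "fwd_diff i c 0 = c i + (\<Sum>j<i. (-1) ^ (i + j) * real (i choose j) * c j)"
  by (simp add: fwd_diff_eq_sum lessThan_Suc_atMost[symmetric])

lemma fwd_diff_cong: "(\<And>j. j \<le> i \<Longrightarrow> c j = d j) \<Longrightarrow> fwd_diff i c 0 = fwd_diff i d 0"
  by (simp add: fwd_diff_eq_sum)

text \<open>The differences at 0 depend on the sequence through a triangular matrix with unit diagonal, so
  they can be prescribed freely.\<close>
lemma fwd_diff_surj: "\<exists>c. \<forall>i<k. fwd_diff i c 0 = d i"
proof (induction k)
  case (Suc k)
  then obtain c where c: "\<forall>i<k. fwd_diff i c 0 = d i" by blast
  define c' where "c' = c(k := d k - (\<Sum>j<k. (-1) ^ (k + j) * real (k choose j) * c j))"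
  have "fwd_diff i c' 0 = d i" if "i < k" for i
    using fwd_diff_cong[of i c' c] c that by (simp add: c'_def)
  moreover have "fwd_diff k c' 0 = d k"
    unfolding fwd_diff_0_split by (simp add: c'_def)
  ultimately show ?case by (auto simp: less_Suc_eq)
qed simp

lemma fwd_diff_eq_0_iff: "(\<forall>i<k. fwd_diff i c 0 = 0) \<longleftrightarrow> (\<forall>i<k. c i = 0)"
proof
  assume diff_0: "\<forall>i<k. fwd_diff i c 0 = 0"
  have "c i = 0" if "i < k" for i
    using that
  proof (induction i rule: less_induct)
    case (less i)
    then have "fwd_diff i c 0 = c i" unfolding fwd_diff_0_split by simp
    then show ?case using diff_0 less.prems by simp
  qed
  then show "\<forall>i<k. c i = 0" by blast
next
  assume "\<forall>i<k. c i = 0"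
  then show "\<forall>i<k. fwd_diff i c 0 = 0" by (simp add: fwd_diff_0_split)
qed

lemma bernstein_form_exists:
  assumes "degree P \<le> m"
  shows "\<exists>p. P = bernstein_form m p"
proof -
  have "\<exists>p. \<forall>i\<le>m. fwd_diff i p 0 = poly ((pderiv ^^ i) P) 0 * fact (m - i) / fact m"
    using fwd_diff_surj[of "Suc m"] by (auto simp: less_Suc_eq_le)
  \<comment> \<open>With these coefficients the Taylor expansions at 0 agree up to the order of the degree bound.\<close>
  then obtain p where p: "fwd_diff i p 0 = poly ((pderiv ^^ i) P) 0 * fact (m - i) / fact m"
    if "i \<le> m" for i by blast
  have "coeff P i = coeff (bernstein_form m p) i" for i
  proof (cases "i \<le> m")
    case True
    have "poly ((pderiv ^^ i) P) 0 = poly ((pderiv ^^ i) (bernstein_form m p)) 0"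
      using True by (simp add: higher_pderiv_bernstein_form_at_0 diff_quot_def p)
    then show ?thesis by (simp add: poly_0_coeff_0 coeff_higher_pderiv pochhammer_fact[symmetric])
  next
    case False
    then show ?thesis using assms degree_bernstein_form[of m p] by (simp add: coeff_eq_0)
  qed
  then show ?thesis by (auto intro: poly_eqI)
qed

lemma bernstein_form_eq_iff:
  "bernstein_form m c = bernstein_form m d \<longleftrightarrow> (\<forall>i\<le>m. c i = d i)"
proof
  assume eq: "bernstein_form m c = bernstein_form m d"
  have "fwd_diff i (\<lambda>i. c i - d i) 0 = 0" if "i < Suc m" for i
  proof -
    have "fact m * diff_quot m i (\<lambda>i. c i - d i) 0 = 0"
      using higher_pderiv_bernstein_form_at_0[of i m "\<lambda>i. c i - d i"] eq
      by (simp add: bernstein_form_diff)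
    then show ?thesis using that by (simp add: diff_quot_def)
  qed
  then have "\<forall>i<Suc m. c i - d i = 0"
    using fwd_diff_eq_0_iff[of "Suc m" "\<lambda>i. c i - d i"] by blast
  then show "\<forall>i\<le>m. c i = d i" by simp
qed (simp add: bernstein_form_def)

section \<open>Derivatives of rational functions\<close>

lemma higher_deriv_poly: "(deriv ^^ i) (poly P) = poly ((pderiv ^^ i) P)"
  for P :: "real poly"
  by (induction i) (auto intro!: DERIV_imp_deriv poly_DERIV)

text \<open>The Leibniz rule.  The hypotheses on all of the open set are what makes the induction work: the
  formula for order \<^term>\<open>i\<close> is differentiated as an identity of functions.\<close>
lemma higher_deriv_mult:
  fixes f g :: "real \<Rightarrow> real"
  assumes "open U"
    and f: "\<And>i x. x \<in> U \<Longrightarrow> ((deriv ^^ i) f has_field_derivative (deriv ^^ Suc i) f x) (at x)"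
    and g: "\<And>i x. x \<in> U \<Longrightarrow> ((deriv ^^ i) g has_field_derivative (deriv ^^ Suc i) g x) (at x)"
  shows "x \<in> U \<Longrightarrow> (deriv ^^ i) (\<lambda>x. f x * g x) x
     = (\<Sum>j\<le>i. real (i choose j) * ((deriv ^^ (i - j)) f x * (deriv ^^ j) g x))"
proof (induction i arbitrary: x)
  case (Suc i)
  let ?F = "\<lambda>j. (deriv ^^ (Suc i - j)) f x * (deriv ^^ j) g x"
  have "((\<lambda>x. \<Sum>j\<le>i. real (i choose j) * ((deriv ^^ (i - j)) f x * (deriv ^^ j) g x))
     has_field_derivative (\<Sum>j\<le>i. real (i choose j) *
        ((deriv ^^ (i - j)) f x * (deriv ^^ Suc j) g x + (deriv ^^ Suc (i - j)) f x * (deriv ^^ j) g x))) (at x)"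
    by (intro DERIV_sum DERIV_cmult DERIV_mult' f g Suc.prems)
  moreover have "(\<Sum>j\<le>i. real (i choose j) *
        ((deriv ^^ (i - j)) f x * (deriv ^^ Suc j) g x + (deriv ^^ Suc (i - j)) f x * (deriv ^^ j) g x))
     = (\<Sum>j\<le>Suc i. real (Suc i choose j) * ?F j)"
    unfolding sum_binomial_Suc sum.distrib[symmetric] distrib_left[symmetric]
    by (intro sum.cong refl) (auto simp: Suc_diff_le simp del: funpow.simps)
  ultimately have "((deriv ^^ i) (\<lambda>x. f x * g x) has_field_derivative
      (\<Sum>j\<le>Suc i. real (Suc i choose j) * ?F j)) (at x)"
    by (auto intro: has_field_derivative_transform_within_open[OF _ \<open>open U\<close> Suc.prems] simp: Suc.IH)
  then show ?case by (simp add: DERIV_imp_deriv del: sum.atMost_Suc)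
qed simp

text \<open>Each derivative of \<open>N / W\<close> is again a polynomial divided by a power of \<open>W\<close>, hence differentiable
  wherever \<open>W\<close> does not vanish.\<close>
lemma higher_deriv_rational_function:
  fixes N W :: "real poly" and g :: "real \<Rightarrow> real"
  assumes "open U" and W: "\<And>x. x \<in> U \<Longrightarrow> poly W x \<noteq> 0"
    and g: "\<And>x. x \<in> U \<Longrightarrow> g x = poly N x / poly W x"
    and "x \<in> U"
  shows "((deriv ^^ i) g has_field_derivative (deriv ^^ Suc i) g x) (at x)"
proof -
  have step: "(h has_field_derivative poly (pderiv A * W - smult (real (Suc i)) (A * pderiv W)) x
           / poly W x ^ Suc (Suc i)) (at x)"
    if h: "\<And>x. x \<in> U \<Longrightarrow> h x = poly A x / poly W x ^ Suc i" and x: "x \<in> U" for h A i x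
  proof -
    have "((\<lambda>x. poly A x / poly W x ^ Suc i) has_field_derivative
      (poly (pderiv A) x * poly W x ^ Suc i - poly A x * (real (Suc i) * (poly (pderiv W) x * poly W x ^ (Suc i - Suc 0))))
        / (poly W x ^ Suc i * poly W x ^ Suc i)) (at x)"
      by (rule DERIV_divide poly_DERIV DERIV_power)+ (use W[OF x] in simp)
    also have "(poly (pderiv A) x * poly W x ^ Suc i - poly A x * (real (Suc i) * (poly (pderiv W) x * poly W x ^ (Suc i - Suc 0))))
        / (poly W x ^ Suc i * poly W x ^ Suc i)
      = poly (pderiv A * W - smult (real (Suc i)) (A * pderiv W)) x / poly W x ^ Suc (Suc i)"
      using W[OF x] by (simp add: divide_simps) (simp add: algebra_simps)
    finally show ?thesis
      by (rule has_field_derivative_transform_within_open[OF _ \<open>open U\<close> x]) (simp add: h)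
  qed
  have "\<exists>A. \<forall>x\<in>U. (deriv ^^ i) g x = poly A x / poly W x ^ Suc i" for i
  proof (induction i)
    case 0
    then show ?case using g by auto
  next
    case (Suc i)
    then obtain A where "\<forall>x\<in>U. (deriv ^^ i) g x = poly A x / poly W x ^ Suc i" by blast
    then have "\<forall>x\<in>U. (deriv ^^ Suc i) g x = poly (pderiv A * W - smult (real (Suc i)) (A * pderiv W)) x
           / poly W x ^ Suc (Suc i)"
      using step[of "(deriv ^^ i) g" A i] by (auto intro!: DERIV_imp_deriv)
    then show ?case by blast
  qed
  then obtain A where A: "\<And>x. x \<in> U \<Longrightarrow> (deriv ^^ i) g x = poly A x / poly W x ^ Suc i" by blast
  from step[OF this \<open>x \<in> U\<close>] show ?thesis
    by (auto simp: DERIV_deriv_iff_has_field_derivative)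
qed

lemma weight_fun_conv_bernstein_form: "weight_fun n \<omega> t = poly (bernstein_form n \<omega>) t"
  by (simp add: weight_fun_def poly_bernstein_form)

lemma rational_bezier_conv_bernstein_form:
  "rational_bezier n \<omega> r t = poly (bernstein_form n (\<lambda>i. \<omega> i * r i)) t / poly (bernstein_form n \<omega>) t"
  by (simp add: rational_bezier_def weight_fun_conv_bernstein_form poly_bernstein_form)

lemma higher_deriv_rational_bezier:
  assumes "poly (bernstein_form n \<omega>) x \<noteq> 0"
  shows "poly ((pderiv ^^ i) (bernstein_form n (\<lambda>i. \<omega> i * r i))) x
     = (\<Sum>j\<le>i. real (i choose j) * (poly ((pderiv ^^ (i - j)) (bernstein_form n \<omega>)) x
          * (deriv ^^ j) (rational_bezier n \<omega> r) x))"
proof -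
  let ?W = "bernstein_form n \<omega>" and ?N = "bernstein_form n (\<lambda>i. \<omega> i * r i)"
  let ?R = "rational_bezier n \<omega> r"
  define U where "U = {x. poly ?W x \<noteq> 0}"
  have "open U" unfolding U_def by (intro open_Collect_neq continuous_intros)
  have "x \<in> U" using assms by (simp add: U_def)
  have "((deriv ^^ i) ?R has_field_derivative (deriv ^^ Suc i) ?R x) (at x)" if "x \<in> U" for i x
    using that
    by (intro higher_deriv_rational_function[OF \<open>open U\<close>, of ?W ?R ?N])
      (auto simp: U_def rational_bezier_conv_bernstein_form)
  then have "(deriv ^^ i) (\<lambda>x. poly ?W x * ?R x) x
     = (\<Sum>j\<le>i. real (i choose j) * ((deriv ^^ (i - j)) (poly ?W) x * (deriv ^^ j) ?R x))"
    by (intro higher_deriv_mult[OF \<open>open U\<close> _ _ \<open>x \<in> U\<close>])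
      (auto simp: higher_deriv_poly DERIV_imp_deriv[OF poly_DERIV] intro!: poly_DERIV)
  moreover have "(deriv ^^ i) (\<lambda>x. poly ?W x * ?R x) x = (deriv ^^ i) (poly ?N) x"
  proof (rule higher_deriv_cong_ev)
    show "\<forall>\<^sub>F y in nhds x. poly ?W y * ?R y = poly ?N y"
      using eventually_nhds_in_open[OF \<open>open U\<close> \<open>x \<in> U\<close>]
      by eventually_elim (simp add: U_def rational_bezier_conv_bernstein_form)
  qed simp
  ultimately show ?thesis by (simp add: higher_deriv_poly)
qed

text \<open>The recursion for \<^const>\<open>rho0\<close> is the Leibniz rule for the numerator as denominator times quotient,
  solved for the highest derivative of the quotient.\<close>
lemma rho0_eq_deriv:
  assumes "\<omega> 0 \<noteq> 0"
  shows "rho0 n \<omega> r i = (deriv ^^ i) (rational_bezier n \<omega> r) 0"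
proof (induction i rule: less_induct)
  case (less i)
  let ?d = "\<lambda>j. (deriv ^^ j) (rational_bezier n \<omega> r) 0"
  have W: "poly (bernstein_form n \<omega>) 0 \<noteq> 0"
    using higher_pderiv_bernstein_form_at_0[of 0 n \<omega>] assms by (simp add: diff_quot_def)
  have "fact n * diff_quot n i (\<lambda>i. \<omega> i * r i) 0
     = (\<Sum>j\<le>i. real (i choose j) * (fact n * diff_quot n (i - j) \<omega> 0 * ?d j))"
    using higher_deriv_rational_bezier[OF W, of i r] by (simp only: higher_pderiv_bernstein_form_at_0)
  also have "\<dots> = \<omega> 0 * ?d i + fact n * (\<Sum>j<i. real (i choose j) * diff_quot n (i - j) \<omega> 0 * ?d j)"
    by (simp add: lessThan_Suc_atMost[symmetric] diff_quot_def[of n 0] sum_distrib_left mult_ac)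
  finally have "?d i = fact n / \<omega> 0 * (diff_quot n i (\<lambda>i. \<omega> i * r i) 0
      - (\<Sum>j<i. real (i choose j) * diff_quot n (i - j) \<omega> 0 * ?d j))"
    using assms by (simp add: field_simps)
  then show ?case by (subst rho0.simps) (simp add: less.IH)
qed

lemma rho1_eq_deriv:
  assumes "\<omega> n \<noteq> 0"
  shows "rho1 n \<omega> r i = (deriv ^^ i) (rational_bezier n \<omega> r) 1"
proof (induction i rule: less_induct)
  case (less i)
  let ?d = "\<lambda>j. (deriv ^^ j) (rational_bezier n \<omega> r) 1"
  have W: "poly (bernstein_form n \<omega>) 1 \<noteq> 0"
    using higher_pderiv_bernstein_form_at_1[of 0 n \<omega>] assms by (simp add: diff_quot_def)
  have "fact n * diff_quot n i (\<lambda>i. \<omega> i * r i) (n - i)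
     = (\<Sum>j\<le>i. real (i choose j) * (fact n * diff_quot n (i - j) \<omega> (n - (i - j)) * ?d j))"
    using higher_deriv_rational_bezier[OF W, of i r] by (simp only: higher_pderiv_bernstein_form_at_1)
  also have "\<dots> = \<omega> n * ?d i
      + fact n * (\<Sum>j<i. real (i choose j) * diff_quot n (i - j) \<omega> (n - (i - j)) * ?d j)"
    by (simp add: lessThan_Suc_atMost[symmetric] diff_quot_def[of n 0] sum_distrib_left mult_ac)
  finally have "?d i = fact n / \<omega> n * (diff_quot n i (\<lambda>i. \<omega> i * r i) (n - i)
      - (\<Sum>j<i. real (i choose j) * diff_quot n (i - j) \<omega> (n - (i - j)) * ?d j))"
    using assms by (simp add: field_simps)
  then show ?case by (subst rho1.simps) (simp add: less.IH)
qed

section \<open>Lagrange interpolation at consecutive integers\<close>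

lemma lagrange_interpolation:
  fixes Q :: "real poly" and I :: "nat set"
  assumes "finite I" and deg: "degree Q < card I"
  shows "poly Q y = (\<Sum>i\<in>I. poly Q (real i) * (\<Prod>q\<in>I - {i}. (y - real q) / (real i - real q)))"
proof -
  define L where "L = (\<Sum>i\<in>I. smult (poly Q (real i))
     (\<Prod>q\<in>I - {i}. smult (1 / (real i - real q)) [:- real q, 1:]))"
  have poly_L: "poly L y = (\<Sum>i\<in>I. poly Q (real i) * (\<Prod>q\<in>I - {i}. (y - real q) / (real i - real q)))" for y
    by (simp add: L_def poly_sum poly_prod diff_divide_distrib)
  have "degree L \<le> card I - 1"
    unfolding L_def
  proof (rule degree_sum_le[OF \<open>finite I\<close>])
    fix i assume "i \<in> I"
    have "degree (\<Prod>q\<in>I - {i}. smult (1 / (real i - real q)) [:- real q, 1:])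
        \<le> (\<Sum>q\<in>I - {i}. degree (smult (1 / (real i - real q)) [:- real q, 1:]))"
      by (rule order.trans[OF degree_prod_sum_le]) (simp_all add: o_def \<open>finite I\<close>)
    also have "\<dots> \<le> (\<Sum>q\<in>I - {i}. 1)" by (intro sum_mono) simp
    finally show "degree (smult (poly Q (real i)) (\<Prod>q\<in>I - {i}. smult (1 / (real i - real q)) [:- real q, 1:]))
       \<le> card I - 1"
      using \<open>i \<in> I\<close> \<open>finite I\<close> by (intro order.trans[OF degree_smult_le]) simp
  qed
  with deg have "degree L < card I" by linarith
  moreover have "poly L (real j) = poly Q (real j)" if "j \<in> I" for j
  proof -
    have "(\<Prod>q\<in>I - {i}. (real j - real q) / (real i - real q)) = (if i = j then 1 else 0)" if "i \<in> I" for i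
    proof (cases "i = j")
      case False
      then show ?thesis using \<open>finite I\<close> \<open>j \<in> I\<close> by (auto intro!: prod_zero)
    qed (auto intro: prod.neutral)
    then have "poly L (real j) = (\<Sum>i\<in>I. if i = j then poly Q (real i) else 0)"
      unfolding poly_L by (intro sum.cong) auto
    then show ?thesis using \<open>finite I\<close> \<open>j \<in> I\<close> by simp
  qed
  ultimately have "L = Q"
    by (intro poly_eqI_degree[of "real ` I"]) (auto simp: card_image deg)
  then show ?thesis using poly_L[of y] by (rule subst)
qed

lemma prod_nodes_eq_fact:
  assumes "k \<le> i" "i \<le> M"
  shows "(\<Prod>q\<in>{k..M} - {i}. real i - real q) = (-1) ^ (M - i) * fact (i - k) * fact (M - i)"
proof -
  have "(\<Prod>q\<in>{k..<i}. real i - real q) = (\<Prod>d\<in>{1..i - k}. real d)"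
    by (rule prod.reindex_bij_witness[of _ "\<lambda>d. i - d" "\<lambda>q. i - q"]) (auto simp: of_nat_diff)
  also have "\<dots> = fact (i - k)" by (simp add: fact_prod)
  finally have 1: "(\<Prod>q\<in>{k..<i}. real i - real q) = fact (i - k)" .
  have "(\<Prod>q\<in>{Suc i..M}. real i - real q) = (\<Prod>d\<in>{1..M - i}. (-1) * real d)"
    by (rule prod.reindex_bij_witness[of _ "\<lambda>d. i + d" "\<lambda>q. q - i"]) (auto simp: of_nat_diff)
  also have "\<dots> = (-1) ^ (M - i) * fact (M - i)"
    unfolding prod.distrib by (simp add: fact_prod)
  finally have 2: "(\<Prod>q\<in>{Suc i..M}. real i - real q) = (-1) ^ (M - i) * fact (M - i)" .
  have "{k..M} - {i} = {k..<i} \<union> {Suc i..M}" using assms by auto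
  then have "(\<Prod>q\<in>{k..M} - {i}. real i - real q)
     = (\<Prod>q\<in>{k..<i} \<union> {Suc i..M}. real i - real q)"
    by (rule arg_cong)
  also have "\<dots> = (\<Prod>q\<in>{k..<i}. real i - real q) * (\<Prod>q\<in>{Suc i..M}. real i - real q)"
    by (rule prod.union_disjoint) auto
  finally show ?thesis unfolding 1 2 by (simp add: mult_ac)
qed

text \<open>The product of \<^term>\<open>y - real q\<close> over all nodes \<^term>\<open>q\<close> is a Pochhammer symbol up to sign, and the
  factor of the node \<^term>\<open>i\<close>, which the Lagrange basis polynomial omits, moves to the denominator.\<close>
lemma lagrange_basis_eq_pochhammer:
  fixes y :: real
  assumes "k \<le> i" "i \<le> M" and y: "y \<noteq> real i"
  shows "(\<Prod>q\<in>{k..M} - {i}. (y - real q) / (real i - real q))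
    = (-1) ^ (i - k) * pochhammer (real k - y) (M - k + 1)
        / ((real i - y) * fact (i - k) * fact (M - i))"
proof -
  have "(\<Prod>q\<in>{k..M}. y - real q) = (\<Prod>d\<in>{0..<M - k + 1}. (-1) * (real k - y + real d))"
    by (rule prod.reindex_bij_witness[of _ "\<lambda>d. k + d" "\<lambda>q. q - k"]) (use assms in \<open>auto simp: of_nat_diff\<close>)
  also have "\<dots> = (-1) ^ (M - k + 1) * pochhammer (real k - y) (M - k + 1)"
    unfolding prod.distrib by (simp add: pochhammer_prod)
  also have "(\<Prod>q\<in>{k..M}. y - real q) = (y - real i) * (\<Prod>q\<in>{k..M} - {i}. y - real q)"
    using assms by (intro prod.remove) auto
  finally have numer: "(\<Prod>q\<in>{k..M} - {i}. y - real q)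
      = (-1) ^ (M - k + 1) * pochhammer (real k - y) (M - k + 1) / (y - real i)"
    using y by (simp add: field_simps)
  have sign: "((-1) ^ (M - k + 1) :: real) = - ((-1) ^ (i - k) * (-1) ^ (M - i))"
    using assms by (simp flip: power_add)
  have cancel: "- (b * a) * p / (y - real i) / (a * f * g) = b * p / ((real i - y) * f * g)"
    if "a \<noteq> 0" for a b f g p :: real
  proof -
    have "- (b * a) * p / (- d) / (a * f * g) = b * p / (d * f * g)" for d
      using that by simp
    from this[of "real i - y"] show ?thesis by simp
  qed
  show ?thesis
    unfolding prod_dividef prod_nodes_eq_fact[OF assms(1,2)] numer sign by (rule cancel) simp
qed

lemma poly_pochhammer_linear: "poly (pochhammer [:a, b:] n) x = pochhammer (a + b * x) n"
  for a b x :: real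
  by (induction n) (simp_all add: pochhammer_Suc mult_ac)

lemma degree_pochhammer_linear_le: "degree (pochhammer [:a, b:] n) \<le> n" for a b :: real
proof (induction n)
  case (Suc n)
  have "degree ([:a, b:] + of_nat n) \<le> 1"
    by (simp add: of_nat_poly)
  then show ?case unfolding pochhammer_Suc using Suc
    by (intro order.trans[OF degree_mult_le]) simp
qed simp

section \<open>The Jacobi inner product\<close>

lemma Gamma_plus_of_nat: "z > 0 \<Longrightarrow> Gamma (z + real n) = pochhammer z n * Gamma z" for z :: real
  by (subst pochhammer_Gamma) (auto elim!: nonpos_Ints_cases simp: Gamma_eq_zero_iff)

lemma continuous_on_Bernstein [continuous_intros]: "continuous_on A (Bernstein n i)"
  unfolding Bernstein_def[abs_def] by (intro continuous_intros)

lemma continuous_on_polynomial [continuous_intros]: "continuous_on A (poly P)"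
  for P :: "real poly"
  by (intro continuous_intros)

lemma Bernstein_mult:
  assumes "h \<le> n" "j \<le> m"
  shows "Bernstein n h t * Bernstein m j t
     = real (n choose h) * real (m choose j) / real ((n + m) choose (j + h)) * Bernstein (n + m) (j + h) t"
proof -
  have "n + m - (j + h) = (n - h) + (m - j)" using assms by simp
  then have "Bernstein (n + m) (j + h) t
      = real ((n + m) choose (j + h)) * (t ^ j * t ^ h) * ((1 - t) ^ (n - h) * (1 - t) ^ (m - j))"
    by (simp only: Bernstein_def power_add of_nat_add)
  moreover have "real ((n + m) choose (j + h)) \<noteq> 0"
    using assms by (simp add: binomial_eq_0_iff)
  ultimately show ?thesis by (simp only: Bernstein_def) simp
qed

lemma weight_fun_pos:
  assumes "\<And>i. i \<le> n \<Longrightarrow> \<omega> i > 0" "t \<in> {0..1}"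
  shows "weight_fun n \<omega> t > 0"
proof -
  have nonneg: "0 \<le> \<omega> i * Bernstein n i t" if "i \<le> n" for i
    using assms that by (simp add: Bernstein_nonneg less_imp_le)
  have "weight_fun n \<omega> t \<noteq> 0"
  proof
    assume "weight_fun n \<omega> t = 0"
    then have "\<forall>i\<le>n. \<omega> i * Bernstein n i t = 0"
      using sum_nonneg_eq_0_iff[of "{..n}" "\<lambda>i. \<omega> i * Bernstein n i t"] nonneg
      by (simp add: weight_fun_def)
    then have "\<forall>i\<le>n. Bernstein n i t = 0" using assms(1) by force
    then show False using sum_Bernstein[of n t] by simp
  qed
  moreover have "weight_fun n \<omega> t \<ge> 0"
    unfolding weight_fun_def using nonneg by (intro sum_nonneg) simp
  ultimately show ?thesis by simp
qed

lemma continuous_on_rational_bezier: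
  assumes "\<And>i. i \<le> n \<Longrightarrow> \<omega> i > 0"
  shows "continuous_on {0..1} (rational_bezier n \<omega> r)"
proof -
  have "\<forall>t\<in>{0..1}. poly (bernstein_form n \<omega>) t \<noteq> 0"
    using weight_fun_pos[OF assms] by (fastforce simp: weight_fun_conv_bernstein_form)
  then show ?thesis
    unfolding rational_bezier_conv_bernstein_form[abs_def] by (intro continuous_intros) auto
qed

lemma jacobi_inner_commute: "jacobi_inner \<alpha> \<beta> f g = jacobi_inner \<alpha> \<beta> g f"
  by (simp add: jacobi_inner_def mult_ac)

lemma jacobi_inner_nonneg: "jacobi_inner \<alpha> \<beta> f f \<ge> 0"
proof -
  have "(1 - t) powr \<alpha> * t powr \<beta> * f t * f t \<ge> 0" for t
    by (simp add: mult.assoc)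
  then have "integral {0..1} (\<lambda>t. (1 - t) powr \<alpha> * t powr \<beta> * f t * f t) \<ge> 0"
    by (cases "(\<lambda>t. (1 - t) powr \<alpha> * t powr \<beta> * f t * f t) integrable_on {0..1}")
      (simp_all add: integral_nonneg not_integrable_integral)
  then show ?thesis by (simp add: jacobi_inner_def)
qed

lemma sq_error_eq_jacobi_inner:
  "sq_error \<alpha> \<beta> R P = jacobi_inner \<alpha> \<beta> (\<lambda>t. R t - poly P t) (\<lambda>t. R t - poly P t)"
  by (simp add: sq_error_def jacobi_inner_def power2_eq_square mult.assoc)

context
  fixes \<alpha> \<beta> :: real
  assumes \<alpha>: "\<alpha> > -1" and \<beta>: "\<beta> > -1"
begin

text \<open>The weight may be unbounded at the endpoints, but it is the integrand of a convergent Beta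
  integral, and a continuous factor is bounded.\<close>
lemma jacobi_weight_absolutely_integrable:
  assumes "continuous_on {0..1} f"
  shows "(\<lambda>t. (1 - t) powr \<alpha> * t powr \<beta> * f t) absolutely_integrable_on {0..1}"
proof -
  have "(\<lambda>t. t powr \<beta> * (1 - t) powr \<alpha>) integrable_on {0..1}"
    using has_integral_Beta_real[of "\<beta> + 1" "\<alpha> + 1"] \<alpha> \<beta> by (auto simp: integrable_on_def)
  then have "(\<lambda>t. t powr \<beta> * (1 - t) powr \<alpha>) absolutely_integrable_on {0..1}"
    by (rule nonnegative_absolutely_integrable_1) simp
  moreover have "f \<in> borel_measurable (lebesgue_on {0..1})"
    using assms by (rule continuous_imp_measurable_on_sets_lebesgue) simp
  moreover have "bounded (f ` {0..1})"
    using assms by (intro compact_imp_bounded compact_continuous_image) auto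
  ultimately have "(\<lambda>t. f t * (t powr \<beta> * (1 - t) powr \<alpha>)) absolutely_integrable_on {0..1}"
    using absolutely_integrable_bounded_measurable_product_real[of f "{0..1}"] by simp
  then show ?thesis by (simp only: mult_ac)
qed

lemma jacobi_integrable:
  assumes "continuous_on {0..1} f" "continuous_on {0..1} g"
  shows "(\<lambda>t. (1 - t) powr \<alpha> * t powr \<beta> * f t * g t) integrable_on {0..1}"
  using jacobi_weight_absolutely_integrable[OF continuous_on_mult[OF assms]]
  by (simp add: absolutely_integrable_on_def mult.assoc)

lemma jacobi_inner_sum:
  assumes "finite S" "\<And>i. i \<in> S \<Longrightarrow> continuous_on {0..1} (f i)" "continuous_on {0..1} g"
  shows "jacobi_inner \<alpha> \<beta> (\<lambda>t. \<Sum>i\<in>S. c i * f i t) g = (\<Sum>i\<in>S. c i * jacobi_inner \<alpha> \<beta> (f i) g)"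
proof -
  have "jacobi_inner \<alpha> \<beta> (\<lambda>t. \<Sum>i\<in>S. c i * f i t) g
     = integral {0..1} (\<lambda>t. \<Sum>i\<in>S. c i * ((1 - t) powr \<alpha> * t powr \<beta> * f i t * g t))"
    by (simp add: jacobi_inner_def sum_distrib_left sum_distrib_right mult_ac)
  also have "\<dots> = (\<Sum>i\<in>S. integral {0..1} (\<lambda>t. c i * ((1 - t) powr \<alpha> * t powr \<beta> * f i t * g t)))"
    by (intro integral_sum integrable_on_mult_right jacobi_integrable assms)
  finally show ?thesis by (simp add: jacobi_inner_def)
qed

lemma jacobi_inner_diff:
  assumes "continuous_on {0..1} f" "continuous_on {0..1} g" "continuous_on {0..1} h"
  shows "jacobi_inner \<alpha> \<beta> (\<lambda>t. f t - g t) h = jacobi_inner \<alpha> \<beta> f h - jacobi_inner \<alpha> \<beta> g h"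
  using integral_diff[OF jacobi_integrable[OF assms(1,3)] jacobi_integrable[OF assms(2,3)]]
  by (simp add: jacobi_inner_def algebra_simps)

lemma jacobi_inner_definite:
  assumes "jacobi_inner \<alpha> \<beta> (poly P) (poly P) = 0"
  shows "P = 0"
proof -
  let ?f = "\<lambda>t. (1 - t) powr \<alpha> * t powr \<beta> * poly P t * poly P t"
  \<comment> \<open>On the inner interval the weight is continuous and positive, whatever the signs of the exponents.\<close>
  have int: "?f integrable_on {0..1}" by (intro jacobi_integrable continuous_intros)
  have cont: "continuous_on {1/4..3/4} ?f" by (intro continuous_intros) auto
  have nonneg: "?f t \<ge> 0" for t by (simp add: mult.assoc)
  have "integral {1/4..3/4} ?f \<le> integral {0..1} ?f"
    by (intro integral_subset_le int integrable_continuous_real cont) (auto intro: nonneg)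
  moreover have "integral {1/4..3/4} ?f \<ge> 0"
    by (intro integral_nonneg integrable_continuous_real cont) (auto intro: nonneg)
  ultimately have "integral {1/4..3/4} ?f = 0"
    using assms by (simp add: jacobi_inner_def)
  then have "\<forall>t\<in>{1/4..3/4}. ?f t = 0"
    using integral_eq_0_iff[OF cont] nonneg by simp
  then have "{1/4..3/4} \<subseteq> {t. poly P t = 0}" by auto
  then have "infinite {t. poly P t = 0}"
    by (rule infinite_super) (simp add: infinite_Icc)
  then show "P = 0" using poly_roots_finite by blast
qed

lemma jacobi_inner_Bernstein:
  assumes "i \<le> m" "s \<le> m"
  shows "jacobi_inner \<alpha> \<beta> (Bernstein m i) (Bernstein m s)
    = real (m choose i) * real (m choose s)
      * Beta (\<beta> + real (i + s) + 1) (\<alpha> + real (2 * m - (i + s)) + 1)"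
proof -
  let ?a = "\<beta> + real (i + s)" and ?b = "\<alpha> + real (2 * m - (i + s))"
  have "?a + 1 > 0" "?b + 1 > 0" using \<alpha> \<beta> by linarith+
  from has_integral_Beta_real[OF this]
  have "integral {0..1} (\<lambda>t. real (m choose i) * real (m choose s) * (t powr ?a * (1 - t) powr ?b))
      = real (m choose i) * real (m choose s) * Beta (?a + 1) (?b + 1)"
    by (simp add: integral_unique)
  also have "integral {0..1} (\<lambda>t. real (m choose i) * real (m choose s) * (t powr ?a * (1 - t) powr ?b))
     = jacobi_inner \<alpha> \<beta> (Bernstein m i) (Bernstein m s)"
    unfolding jacobi_inner_def
  proof (rule integral_cong)
    fix t :: real assume t: "t \<in> {0..1}"
    \<comment> \<open>This includes \<^term>\<open>x = 0\<close>, where both sides vanish because \<^term>\<open>0 powr c = (0 :: real)\<close>.\<close>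
    have powr_plus: "x powr (c + real d) = x powr c * x ^ d" if "x \<ge> 0" for x c d
      using that by (cases "x = 0") (auto simp: powr_add powr_realpow)
    have "2 * m - (i + s) = (m - i) + (m - s)" using assms by simp
    then have "(1 - t) ^ (2 * m - (i + s)) = (1 - t) ^ (m - i) * (1 - t) ^ (m - s)"
      by (simp only: power_add)
    then show "real (m choose i) * real (m choose s) * (t powr ?a * (1 - t) powr ?b)
      = (1 - t) powr \<alpha> * t powr \<beta> * Bernstein m i t * Bernstein m s t"
      using t by (simp only: powr_plus atLeastAtMost_iff diff_ge_0_iff_ge)
        (simp add: Bernstein_def power_add mult_ac)
  qed
  finally show ?thesis by simp
qed

text \<open>In the Beta integral for \<open>\<langle>B x, B s\<rangle>\<close> the two Gamma factors in the numerator are \<open>\<Gamma> (b + x + (s - k))\<close> and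
  \<open>\<Gamma> (a + (m - x) + (m - l - s))\<close> with \<open>a = \<alpha> + l + 1\<close> and \<open>b = \<beta> + k + 1\<close>.  Divided by
  \<open>\<Gamma> (b + x) * \<Gamma> (a + (m - x))\<close> their product is a polynomial in \<open>x\<close> of degree at most
  \<open>(s - k) + (m - l - s) = m - l - k\<close>, so its value at \<open>j\<close> is
  recovered from its values at the nodes \<open>k, ..., m - l\<close>.  Multiplying the Lagrange weights by the ratios
  of the binomial and Gamma factors that were split off gives \<^const>\<open>K_coeff\<close>.\<close>
lemma jacobi_inner_Bernstein_outer:
  assumes kl: "k + l \<le> m" and s: "s \<in> {k..m-l}" and j: "j \<le> m" "j \<notin> {k..m-l}"
  shows "jacobi_inner \<alpha> \<beta> (Bernstein m j) (Bernstein m s)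
    = (\<Sum>i=k..m-l. K_coeff \<alpha> \<beta> m k l i j * jacobi_inner \<alpha> \<beta> (Bernstein m i) (Bernstein m s))"
proof -
  define a where "a = \<alpha> + real l + 1"
  define b where "b = \<beta> + real k + 1"
  have ab: "a > 0" "b > 0" using \<alpha> \<beta> by (simp_all add: a_def b_def)
  \<comment> \<open>Factoring the Gamma values at \<^term>\<open>a\<close> and \<^term>\<open>b\<close> out of the Beta integral leaves \<^term>\<open>Q\<close>.\<close>
  define Q where "Q = pochhammer [:b, 1:] (s - k) * pochhammer [:a + real m, -1:] (m - l - s)"
  define w where "w x = pochhammer a (m - x) * pochhammer b x" for x
  define Z where "Z = real (m choose s) * Gamma a * Gamma b / Gamma (\<alpha> + \<beta> + 2 * real m + 2)"
  have w_pos: "w x > 0" for x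
    using ab by (simp add: w_def pochhammer_pos)
  have inner: "jacobi_inner \<alpha> \<beta> (Bernstein m x) (Bernstein m s)
     = real (m choose x) * w x * Z * poly Q (real x)" if "x \<le> m" for x
  proof -
    have "\<beta> + real (x + s) + 1 = b + real x + real (s - k)"
      using s by (simp add: b_def of_nat_diff)
    then have 1: "Gamma (\<beta> + real (x + s) + 1)
       = pochhammer (b + real x) (s - k) * (pochhammer b x * Gamma b)"
      using ab by (simp only: Gamma_plus_of_nat add_pos_nonneg of_nat_0_le_iff)
    have "2 * m - (x + s) = l + (m - x) + (m - l - s)"
      using s kl that by auto
    then have "\<alpha> + real (2 * m - (x + s)) + 1 = a + real (m - x) + real (m - l - s)"
      by (simp add: a_def)
    then have "Gamma (\<alpha> + real (2 * m - (x + s)) + 1)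
       = pochhammer (a + real (m - x)) (m - l - s) * (pochhammer a (m - x) * Gamma a)"
      using ab by (simp only: Gamma_plus_of_nat add_pos_nonneg of_nat_0_le_iff)
    also have "a + real (m - x) = a + real m - real x" using that by (simp add: of_nat_diff)
    finally have 2: "Gamma (\<alpha> + real (2 * m - (x + s)) + 1)
       = pochhammer (a + real m - real x) (m - l - s) * (pochhammer a (m - x) * Gamma a)" .
    have "x + s \<le> 2 * m" using that s by auto
    then have 3: "\<beta> + real (x + s) + 1 + (\<alpha> + real (2 * m - (x + s)) + 1) = \<alpha> + \<beta> + 2 * real m + 2"
      by (simp add: of_nat_diff)
    have "s \<le> m" using s by auto
    then show ?thesis
      unfolding Z_def w_def Q_def jacobi_inner_Bernstein[OF that \<open>s \<le> m\<close>] Beta_def 1 2 3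
      by (simp add: poly_pochhammer_linear mult_ac)
  qed
  have "degree Q \<le> (s - k) + (m - l - s)"
    unfolding Q_def by (intro order.trans[OF degree_mult_le] add_mono degree_pochhammer_linear_le)
  also have "\<dots> < card {k..m-l}" using s by auto
  finally have deg: "degree Q < card {k..m-l}" .
  have K: "K_coeff \<alpha> \<beta> m k l i j * real (m choose i) * w i
     = real (m choose j) * w j * (\<Prod>q\<in>{k..m-l} - {i}. (real j - real q) / (real i - real q))"
    if i: "i \<in> {k..m-l}" for i
  proof -
    have "i \<le> m" using i by auto
    then have "real (m choose i) \<noteq> 0" by (simp add: binomial_eq_0_iff)
    moreover have "K_coeff \<alpha> \<beta> m k l i j = real (m choose j) / real (m choose i)
       * (\<Prod>q\<in>{k..m-l} - {i}. (real j - real q) / (real i - real q)) * (w j / w i)"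
    proof -
      have swap: "m - k - l = m - l - k" by simp
      have lagrange: "(\<Prod>q\<in>{k..m-l} - {i}. (real j - real q) / (real i - real q))
        = (-1) ^ (i - k) * pochhammer (real k - real j) (m - l - k + 1)
            / ((real i - real j) * fact (i - k) * fact (m - l - i))"
        using i j by (intro lagrange_basis_eq_pochhammer) auto
      show ?thesis unfolding K_coeff_def swap lagrange w_def a_def b_def ..
    qed
    ultimately show ?thesis using w_pos[of i] by simp
  qed
  have "(\<Sum>i=k..m-l. K_coeff \<alpha> \<beta> m k l i j * jacobi_inner \<alpha> \<beta> (Bernstein m i) (Bernstein m s))
    = (\<Sum>i=k..m-l. (K_coeff \<alpha> \<beta> m k l i j * real (m choose i) * w i) * Z * poly Q (real i))"
    by (intro sum.cong refl) (auto simp: inner)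
  also have "\<dots> = (\<Sum>i=k..m-l. real (m choose j) * w j * Z *
     (poly Q (real i) * (\<Prod>q\<in>{k..m-l} - {i}. (real j - real q) / (real i - real q))))"
    by (intro sum.cong refl, subst K) (simp_all add: mult_ac)
  also have "\<dots> = real (m choose j) * w j * Z * poly Q (real j)"
    by (simp add: sum_distrib_left[symmetric] lagrange_interpolation[of "{k..m-l}", OF _ deg, symmetric])
  also have "\<dots> = jacobi_inner \<alpha> \<beta> (Bernstein m j) (Bernstein m s)"
    using inner[OF j(1)] by simp
  finally show ?thesis by simp
qed

end

section \<open>The constrained space\<close>

lemma bernstein_form_in_constrained_space_iff:
  assumes "k + l \<le> m"
  shows "bernstein_form m c \<in> constrained_space m k l
    \<longleftrightarrow> (\<forall>i<k. c i = 0) \<and> (\<forall>j<l. c (m - j) = 0)"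
proof -
  have "(\<forall>i<k. poly ((pderiv ^^ i) (bernstein_form m c)) 0 = 0) \<longleftrightarrow> (\<forall>i<k. fwd_diff i c 0 = 0)"
    using assms by (auto simp: higher_pderiv_bernstein_form_at_0 diff_quot_def)
  also have "\<dots> \<longleftrightarrow> (\<forall>i<k. c i = 0)"
    by (rule fwd_diff_eq_0_iff)
  finally have 0: "(\<forall>i<k. poly ((pderiv ^^ i) (bernstein_form m c)) 0 = 0) \<longleftrightarrow> (\<forall>i<k. c i = 0)" .
  let ?c = "\<lambda>j. c (m - j)"
  have "(\<forall>i<l. poly ((pderiv ^^ i) (bernstein_form m c)) 1 = 0) \<longleftrightarrow> (\<forall>i<l. fwd_diff i ?c 0 = 0)"
    using assms by (auto simp: higher_pderiv_bernstein_form_at_1 diff_quot_def fwd_diff_reverse)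
  also have "\<dots> \<longleftrightarrow> (\<forall>i<l. ?c i = 0)"
    by (rule fwd_diff_eq_0_iff)
  finally show ?thesis
    using 0 by (simp add: constrained_space_def degree_bernstein_form)
qed

text \<open>\<open>inner\<close> refers to the indices away from both ends, not to the inner product.\<close>
definition inner_form :: "nat \<Rightarrow> nat \<Rightarrow> nat \<Rightarrow> (nat \<Rightarrow> real) \<Rightarrow> real poly" where
  "inner_form m k l c = bernstein_form m (\<lambda>j. if j \<in> {k..m-l} then c j else 0)"

lemma poly_inner_form: "poly (inner_form m k l c) t = (\<Sum>j=k..m-l. c j * Bernstein m j t)"
proof -
  have "(\<Sum>j=k..m-l. c j * Bernstein m j t) = (\<Sum>j\<le>m. if j \<in> {k..m-l} then c j * Bernstein m j t else 0)"
    by (rule sum.mono_neutral_cong_left) auto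
  then show ?thesis
    by (simp add: inner_form_def poly_bernstein_form if_distrib[of "\<lambda>x. x * _"] cong: if_cong)
qed

lemma inner_form_linear:
  "inner_form m k l (\<lambda>j. a * c j + d j) = smult a (inner_form m k l c) + inner_form m k l d"
  by (simp add: poly_eq_poly_eq_iff[symmetric] fun_eq_iff poly_inner_form sum.distrib
      sum_distrib_left distrib_right mult.assoc)

lemma inner_form_eq_0_iff: "inner_form m k l c = 0 \<longleftrightarrow> (\<forall>j\<in>{k..m-l}. c j = 0)"
proof -
  have "bernstein_form m (\<lambda>_. 0) = 0" by (simp add: bernstein_form_def)
  moreover have "inner_form m k l c = bernstein_form m (\<lambda>_. 0)
      \<longleftrightarrow> (\<forall>j\<le>m. (if j \<in> {k..m-l} then c j else 0) = 0)"
    by (simp only: inner_form_def bernstein_form_eq_iff)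
  ultimately show ?thesis by auto
qed

lemma constrained_space_eq_range:
  assumes "k + l \<le> m"
  shows "constrained_space m k l = range (inner_form m k l)"
proof (intro set_eqI iffI)
  fix P assume P: "P \<in> constrained_space m k l"
  then obtain c where c: "P = bernstein_form m c"
    using bernstein_form_exists[of P m] by (auto simp: constrained_space_def)
  have "c i = 0" if "i \<le> m" "i \<notin> {k..m-l}" for i
  proof (cases "i < k")
    case False
    with that have "m - i < l" "i = m - (m - i)" by auto
    then show ?thesis
      using P bernstein_form_in_constrained_space_iff[OF assms, of c] c by metis
  qed (use P bernstein_form_in_constrained_space_iff[OF assms, of c] c in simp)
  then have "P = inner_form m k l c"
    by (auto simp: c inner_form_def bernstein_form_eq_iff)
  then show "P \<in> range (inner_form m k l)" by blast
next
  fix P assume "P \<in> range (inner_form m k l)"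
  then show "P \<in> constrained_space m k l"
    using assms by (auto simp: inner_form_def bernstein_form_in_constrained_space_iff)
qed

interpretation real_poly: vector_space "smult :: real \<Rightarrow> real poly \<Rightarrow> real poly"
  by unfold_locales (simp_all add: smult_add_left smult_add_right)

lemma subspace_constrained_space:
  assumes "k + l \<le> m"
  shows "real_poly.subspace (constrained_space m k l)"
  unfolding constrained_space_eq_range[OF assms]
proof (rule real_poly.subspaceI)
  show "0 \<in> range (inner_form m k l)"
    using inner_form_eq_0_iff[of m k l "\<lambda>_. 0"] by (metis rangeI)
  show "P + Q \<in> range (inner_form m k l)"
    if "P \<in> range (inner_form m k l)" "Q \<in> range (inner_form m k l)" for P Q
    using that inner_form_linear[of m k l 1] by (auto simp: image_iff) metis
  show "smult a P \<in> range (inner_form m k l)" if "P \<in> range (inner_form m k l)" for a P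
    using that inner_form_linear[of m k l a _ "\<lambda>_. 0"] inner_form_eq_0_iff[of m k l "\<lambda>_. 0"]
    by (auto simp: image_iff) metis
qed

lemma admissible_diff:
  "admissible m k l R P \<Longrightarrow> admissible m k l R Q \<Longrightarrow> P - Q \<in> constrained_space m k l"
  using higher_pderiv_add[of _ "P - Q" Q]
  by (auto simp: admissible_def constrained_space_def degree_diff_le)

lemma admissible_add:
  "admissible m k l R P \<Longrightarrow> Q \<in> constrained_space m k l \<Longrightarrow> admissible m k l R (P + Q)"
  by (auto simp: admissible_def constrained_space_def higher_pderiv_add degree_add_le)

lemma admissible_bernstein_form_iff:
  assumes "k + l \<le> m"
  shows "admissible m k l R (bernstein_form m p) \<longleftrightarrow>
     (\<forall>i<k. fwd_diff i p 0 = fact (m - i) / fact m * (deriv ^^ i) R 0) \<and>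
     (\<forall>i<l. fwd_diff i (\<lambda>j. p (m - j)) 0 = (-1) ^ i * (fact (m - i) / fact m) * (deriv ^^ i) R 1)"
proof -
  have 0: "poly ((pderiv ^^ i) (bernstein_form m p)) 0 = (deriv ^^ i) R 0
      \<longleftrightarrow> fwd_diff i p 0 = fact (m - i) / fact m * (deriv ^^ i) R 0" if "i < k" for i
    using that assms by (auto simp: higher_pderiv_bernstein_form_at_0 diff_quot_def field_simps)
  have 1: "poly ((pderiv ^^ i) (bernstein_form m p)) 1 = (deriv ^^ i) R 1
      \<longleftrightarrow> fwd_diff i (\<lambda>j. p (m - j)) 0 = (-1) ^ i * (fact (m - i) / fact m) * (deriv ^^ i) R 1" if "i < l" for i
  proof -
    have "(-1) ^ i * (-1) ^ i = (1 :: real)" by (simp flip: power_mult_distrib)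
    then have flip_sign: "(-1) ^ i * x = y \<longleftrightarrow> x = (-1) ^ i * y" for x y :: real
      by (metis mult.assoc mult_1)
    have "i \<le> m" using that assms by simp
    then have "poly ((pderiv ^^ i) (bernstein_form m p)) 1
        = (-1) ^ i * (fact m / fact (m - i) * fwd_diff i (\<lambda>j. p (m - j)) 0)"
      by (simp add: higher_pderiv_bernstein_form_at_1 diff_quot_def fwd_diff_reverse)
    then have "poly ((pderiv ^^ i) (bernstein_form m p)) 1 = (deriv ^^ i) R 1
        \<longleftrightarrow> fact m / fact (m - i) * fwd_diff i (\<lambda>j. p (m - j)) 0 = (-1) ^ i * (deriv ^^ i) R 1"
      by (simp only: flip_sign)
    also have "\<dots> \<longleftrightarrow> fwd_diff i (\<lambda>j. p (m - j)) 0 = (-1) ^ i * (fact (m - i) / fact m) * (deriv ^^ i) R 1"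
      by (auto simp: field_simps)
    finally show ?thesis .
  qed
  show ?thesis using 0 1 by (auto simp: admissible_def degree_bernstein_form)
qed

lemma admissible_exists:
  assumes "k + l \<le> m"
  shows "\<exists>P. admissible m k l R P"
proof -
  obtain c where c: "\<forall>i<k. fwd_diff i c 0 = fact (m - i) / fact m * (deriv ^^ i) R 0"
    using fwd_diff_surj[of k "\<lambda>i. fact (m - i) / fact m * (deriv ^^ i) R 0"] by blast
  obtain d where d: "\<forall>i<l. fwd_diff i d 0 = (-1) ^ i * (fact (m - i) / fact m) * (deriv ^^ i) R 1"
    using fwd_diff_surj[of l "\<lambda>i. (-1) ^ i * (fact (m - i) / fact m) * (deriv ^^ i) R 1"] by blast
  \<comment> \<open>The two triangular systems do not interact: \<^term>\<open>m - j\<close> with \<^term>\<open>j < l\<close> is at least \<^term>\<open>k\<close>.\<close>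
  define p where "p = (\<lambda>j. if j < k then c j else d (m - j))"
  have "fwd_diff i p 0 = fwd_diff i c 0" if "i < k" for i
    by (rule fwd_diff_cong) (use that in \<open>simp add: p_def\<close>)
  moreover have "fwd_diff i (\<lambda>j. p (m - j)) 0 = fwd_diff i d 0" if "i < l" for i
  proof (rule fwd_diff_cong)
    fix j assume "j \<le> i"
    then have "\<not> m - j < k" "m - (m - j) = j" using that assms by auto
    then show "p (m - j) = d j" by (simp add: p_def)
  qed
  ultimately show ?thesis
    using c d admissible_bernstein_form_iff[OF assms, of R p] by auto
qed

section \<open>The constrained dual Bernstein basis\<close>

text \<open>Positive definite matrices are invertible.  The induction adds one index at a time and corrects the
  solution on the smaller set by one step of Gram-Schmidt orthogonalisation.\<close>
lemma positive_definite_solvable: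
  fixes G :: "'a \<Rightarrow> 'a \<Rightarrow> real"
  assumes "finite S"
    and pos: "\<And>x. \<exists>i\<in>S. x i \<noteq> 0 \<Longrightarrow> (\<Sum>i\<in>S. \<Sum>j\<in>S. x i * x j * G i j) > 0"
  shows "\<exists>x. \<forall>j\<in>S. (\<Sum>i\<in>S. x i * G i j) = g j"
  using assms
proof (induction S arbitrary: g rule: finite_induct)
  case empty
  then show ?case by simp
next
  case (insert a S)
  have restrict: "(\<Sum>i\<in>insert a S. f i) = (\<Sum>i\<in>S. f i)" if "f a = 0" for f :: "'a \<Rightarrow> real"
    using insert.hyps that by simp
  \<comment> \<open>A vector on \<^term>\<open>S\<close>, extended by zero at \<^term>\<open>a\<close>, shows that the restricted form is positive definite.\<close>
  have posS: "(\<Sum>i\<in>S. \<Sum>j\<in>S. x i * x j * G i j) > 0" if "\<exists>i\<in>S. x i \<noteq> 0" for x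
  proof -
    define y where "y = x(a := 0)"
    have "\<exists>i\<in>insert a S. y i \<noteq> 0" using that insert.hyps by (auto simp: y_def)
    then have "(\<Sum>i\<in>insert a S. \<Sum>j\<in>insert a S. y i * y j * G i j) > 0" by (rule insert.prems)
    moreover have "(\<Sum>i\<in>insert a S. \<Sum>j\<in>insert a S. y i * y j * G i j)
      = (\<Sum>i\<in>S. \<Sum>j\<in>S. y i * y j * G i j)"
      by (subst restrict, simp add: y_def, rule sum.cong[OF refl], rule restrict) (simp add: y_def)
    moreover have "\<dots> = (\<Sum>i\<in>S. \<Sum>j\<in>S. x i * x j * G i j)"
      using insert.hyps by (intro sum.cong refl) (auto simp: y_def)
    ultimately show ?thesis by simp
  qed
  obtain d where d: "\<forall>j\<in>S. (\<Sum>i\<in>S. d i * G i j) = G a j"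
    using insert.IH[of "G a", OF posS] by blast
  obtain c where c: "\<forall>j\<in>S. (\<Sum>i\<in>S. c i * G i j) = g j"
    using insert.IH[of g, OF posS] by blast
  \<comment> \<open>\<^term>\<open>e\<close> is the unit vector at \<^term>\<open>a\<close> made orthogonal, with respect to \<^term>\<open>G\<close>, to the
    unit vectors of \<^term>\<open>S\<close>;
    adding a multiple of it corrects the equation at \<^term>\<open>a\<close> and leaves the others intact.\<close>
  define e where "e = (\<lambda>i. if i = a then 1 else - d i)"
  have e_sum: "(\<Sum>i\<in>insert a S. e i * G i j) = G a j - (\<Sum>i\<in>S. d i * G i j)" for j
  proof -
    have "(\<Sum>i\<in>S. e i * G i j) = (\<Sum>i\<in>S. - (d i * G i j))"
      using insert.hyps by (intro sum.cong) (auto simp: e_def)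
    then show ?thesis using insert.hyps by (simp add: e_def sum_negf)
  qed
  have "0 < (\<Sum>i\<in>insert a S. \<Sum>j\<in>insert a S. e i * e j * G i j)"
    by (rule insert.prems) (auto simp: e_def)
  also have "\<dots> = (\<Sum>j\<in>insert a S. e j * (\<Sum>i\<in>insert a S. e i * G i j))"
    by (subst sum.swap) (simp add: sum_distrib_left mult_ac)
  also have "\<dots> = e a * (\<Sum>i\<in>insert a S. e i * G i a)"
    using insert.hyps d by (subst sum.insert) (auto simp del: sum.insert simp: e_sum)
  finally have pos_a: "(\<Sum>i\<in>insert a S. e i * G i a) > 0" by (simp add: e_def)
  define z where "z = (g a - (\<Sum>i\<in>S. c i * G i a)) / (\<Sum>i\<in>insert a S. e i * G i a)"
  define x where "x = (\<lambda>i. (if i = a then 0 else c i) + z * e i)"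
  have x_sum: "(\<Sum>i\<in>insert a S. x i * G i j)
      = (\<Sum>i\<in>S. c i * G i j) + z * (\<Sum>i\<in>insert a S. e i * G i j)" for j
  proof -
    have "(\<Sum>i\<in>insert a S. x i * G i j)
      = (\<Sum>i\<in>insert a S. (if i = a then 0 else c i) * G i j) + z * (\<Sum>i\<in>insert a S. e i * G i j)"
      by (simp add: x_def sum.distrib sum_distrib_left algebra_simps del: sum.insert)
    also have "(\<Sum>i\<in>insert a S. (if i = a then 0 else c i) * G i j) = (\<Sum>i\<in>S. c i * G i j)"
      by (subst restrict, simp) (use insert.hyps in \<open>auto intro!: sum.cong\<close>)
    finally show ?thesis .
  qed
  have "\<forall>j\<in>insert a S. (\<Sum>i\<in>insert a S. x i * G i j) = g j"
  proof
    fix j assume "j \<in> insert a S"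
    then consider "j = a" | "j \<in> S" by auto
    then show "(\<Sum>i\<in>insert a S. x i * G i j) = g j"
    proof cases
      case 1
      then show ?thesis using pos_a unfolding x_sum z_def by simp
    next
      case 2
      then show ?thesis unfolding x_sum e_sum using c d by simp
    qed
  qed
  then show ?case by blast
qed

context
  fixes \<alpha> \<beta> :: real
  assumes \<alpha>: "\<alpha> > -1" and \<beta>: "\<beta> > -1"
begin

lemma jacobi_inner_inner_form:
  assumes "continuous_on {0..1} g"
  shows "jacobi_inner \<alpha> \<beta> (poly (inner_form m k l c)) g
    = (\<Sum>j=k..m-l. c j * jacobi_inner \<alpha> \<beta> (Bernstein m j) g)"
  unfolding poly_inner_form[abs_def]
  by (rule jacobi_inner_sum[OF \<alpha> \<beta>]) (intro continuous_intros assms | simp)+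

lemma jacobi_inner_inner_form_right:
  assumes "continuous_on {0..1} g"
  shows "jacobi_inner \<alpha> \<beta> g (poly (inner_form m k l c))
    = (\<Sum>j=k..m-l. c j * jacobi_inner \<alpha> \<beta> g (Bernstein m j))"
  using jacobi_inner_inner_form[OF assms] by (simp add: jacobi_inner_commute[of _ _ g])

lemma constrained_space_orthogonal_imp_0:
  assumes "k + l \<le> m" and P: "P \<in> constrained_space m k l"
    and orth: "\<And>j. j \<in> {k..m-l} \<Longrightarrow> jacobi_inner \<alpha> \<beta> (poly P) (Bernstein m j) = 0"
  shows "P = 0"
proof (rule jacobi_inner_definite[OF \<alpha> \<beta>])
  obtain c where c: "P = inner_form m k l c"
    using P constrained_space_eq_range[OF assms(1)] by blast
  have "jacobi_inner \<alpha> \<beta> (poly P) (poly (inner_form m k l c)) = 0"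
    by (subst jacobi_inner_inner_form_right) (auto intro!: continuous_intros simp: orth)
  then show "jacobi_inner \<alpha> \<beta> (poly P) (poly P) = 0" using c by simp
qed

text \<open>The Gram matrix of the Bernstein polynomials is positive definite, so its rows can be combined to
  the rows of the identity matrix.\<close>
lemma dual_family_exists:
  "\<exists>D. (\<forall>i. D i \<in> range (inner_form m k l)) \<and>
    (\<forall>i\<in>{k..m-l}. \<forall>j\<in>{k..m-l}.
        jacobi_inner \<alpha> \<beta> (poly (D i)) (Bernstein m j) = (if i = j then 1 else 0))"
proof -
  let ?G = "\<lambda>i j. jacobi_inner \<alpha> \<beta> (Bernstein m i) (Bernstein m j)"
  have "(\<Sum>i\<in>{k..m-l}. \<Sum>j\<in>{k..m-l}. x i * x j * ?G i j) > 0" if "\<exists>i\<in>{k..m-l}. x i \<noteq> 0" for x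
  proof -
    let ?P = "inner_form m k l x"
    have "?P \<noteq> 0" using that by (simp add: inner_form_eq_0_iff)
    then have "jacobi_inner \<alpha> \<beta> (poly ?P) (poly ?P) > 0"
      using jacobi_inner_definite[OF \<alpha> \<beta>, of ?P] jacobi_inner_nonneg[of \<alpha> \<beta> "poly ?P"] by fastforce
    also have "jacobi_inner \<alpha> \<beta> (poly ?P) (poly ?P)
       = (\<Sum>i=k..m-l. x i * (\<Sum>j=k..m-l. x j * ?G i j))"
      by (subst jacobi_inner_inner_form, intro continuous_intros,
          subst jacobi_inner_inner_form_right, intro continuous_intros, rule refl)
    finally show ?thesis by (simp add: sum_distrib_left mult.assoc)
  qed
  from positive_definite_solvable[OF _ this]
  have "\<exists>x. \<forall>j\<in>{k..m-l}. (\<Sum>i\<in>{k..m-l}. x i * ?G i j) = (if i = j then 1 else 0)" for i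
    by simp
  then obtain c where c: "(\<Sum>i'\<in>{k..m-l}. c i i' * ?G i' j) = (if i = j then 1 else 0)"
    if "j \<in> {k..m-l}" for i j by metis
  then show ?thesis
    by (intro exI[of _ "\<lambda>i. inner_form m k l (c i)"])
      (auto simp: jacobi_inner_inner_form continuous_on_Bernstein)
qed

lemma constrained_dual_basis_exists:
  assumes "k + l \<le> m"
  shows "\<exists>D. is_constrained_dual_basis \<alpha> \<beta> m k l D"
proof -
  let ?I = "{k..m-l}"
  obtain D where D: "\<And>i. D i \<in> constrained_space m k l"
    and dual: "\<And>i j. i \<in> ?I \<Longrightarrow> j \<in> ?I \<Longrightarrow>
        jacobi_inner \<alpha> \<beta> (poly (D i)) (Bernstein m j) = (if i = j then 1 else 0)"
    using dual_family_exists[of m k l] unfolding constrained_space_eq_range[OF assms, symmetric] by blast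
  have inj: "inj_on D ?I"
    by (rule inj_onI) (metis dual zero_neq_one)
  have comb: "jacobi_inner \<alpha> \<beta> (poly (\<Sum>i\<in>?I. smult (c i) (D i))) (Bernstein m j) = c j"
    if j: "j \<in> ?I" for c j
  proof -
    have "poly (\<Sum>i\<in>?I. smult (c i) (D i)) = (\<lambda>t. \<Sum>i\<in>?I. c i * poly (D i) t)"
      by (simp add: fun_eq_iff poly_sum)
    then have "jacobi_inner \<alpha> \<beta> (poly (\<Sum>i\<in>?I. smult (c i) (D i))) (Bernstein m j)
       = (\<Sum>i\<in>?I. c i * jacobi_inner \<alpha> \<beta> (poly (D i)) (Bernstein m j))"
      by (simp only:) (rule jacobi_inner_sum[OF \<alpha> \<beta>], (intro continuous_intros | simp)+)
    also have "\<dots> = (\<Sum>i\<in>?I. if i = j then c i else 0)"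
      by (intro sum.cong refl) (simp add: dual j del: atLeastAtMost_iff)
    finally show ?thesis using j by simp
  qed
  have "\<not> real_poly.dependent (D ` ?I)"
  proof
    assume "real_poly.dependent (D ` ?I)"
    then obtain u i where i: "i \<in> ?I" "u (D i) \<noteq> 0"
      and "(\<Sum>v\<in>D ` ?I. smult (u v) v) = 0"
      by (auto simp: real_poly.dependent_finite)
    then have "(\<Sum>i\<in>?I. smult (u (D i)) (D i)) = 0"
      by (simp add: sum.reindex[OF inj])
    then have "jacobi_inner \<alpha> \<beta> (poly (\<Sum>i\<in>?I. smult (u (D i)) (D i))) (Bernstein m i) = 0"
      by (simp add: jacobi_inner_def)
    with comb[OF i(1), of "\<lambda>i. u (D i)"] i(2) show False by simp
  qed
  moreover have "real_poly.span (D ` ?I) = constrained_space m k l"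
  proof
    show "real_poly.span (D ` ?I) \<subseteq> constrained_space m k l"
      using D by (intro real_poly.span_minimal subspace_constrained_space[OF assms]) auto
    show "constrained_space m k l \<subseteq> real_poly.span (D ` ?I)"
    proof
      fix P assume P: "P \<in> constrained_space m k l"
      \<comment> \<open>\<^term>\<open>P\<close> and its dual expansion have the same inner products with all basis elements.\<close>
      define Q where "Q = (\<Sum>i\<in>?I. smult (jacobi_inner \<alpha> \<beta> (poly P) (Bernstein m i)) (D i))"
      have Q: "Q \<in> constrained_space m k l"
        unfolding Q_def using D subspace_constrained_space[OF assms]
        by (intro real_poly.subspace_sum real_poly.subspace_scale)
      have Q_span: "Q \<in> real_poly.span (D ` ?I)"
        unfolding Q_def by (intro real_poly.span_sum real_poly.span_scale real_poly.span_base imageI)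
      have "P - Q = 0"
      proof (rule constrained_space_orthogonal_imp_0[OF assms])
        show "P - Q \<in> constrained_space m k l"
          by (intro real_poly.subspace_diff subspace_constrained_space[OF assms] P Q)
        show "jacobi_inner \<alpha> \<beta> (poly (P - Q)) (Bernstein m j) = 0" if "j \<in> ?I" for j
          using jacobi_inner_diff[OF \<alpha> \<beta>, of "poly P" "poly Q" "Bernstein m j"] comb[OF that]
          by (simp add: continuous_intros Q_def poly_diff[abs_def])
      qed
      then show "P \<in> real_poly.span (D ` ?I)" using Q_span by simp
    qed
  qed
  ultimately show ?thesis
    using inj dual by (auto simp: is_constrained_dual_basis_def)
qed

context
  fixes k l m :: nat
  assumes kl: "k + l \<le> m"
begin

abbreviation "D \<equiv> constrained_dual_bernstein \<alpha> \<beta> m k l"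

lemma constrained_dual_bernstein_is_dual_basis: "is_constrained_dual_basis \<alpha> \<beta> m k l D"
  unfolding constrained_dual_bernstein_def
  using constrained_dual_basis_exists[OF kl] by (rule someI_ex)

lemma dual_coeff_expansion:
  assumes "i \<in> {k..m-l}"
  shows "D i = inner_form m k l (dual_coeff \<alpha> \<beta> m k l i)"
proof -
  have "D i \<in> range (inner_form m k l)" if "i \<in> {k..m-l}" for i
    using constrained_dual_bernstein_is_dual_basis that real_poly.span_base[of "D i" "D ` {k..m-l}"]
    by (simp add: is_constrained_dual_basis_def constrained_space_eq_range[OF kl])
  then have "\<forall>i\<in>{k..m-l}. \<exists>c. D i = inner_form m k l c" by blast
  then have "\<exists>c. \<forall>i\<in>{k..m-l}. D i = inner_form m k l (c i)" by metis
  then have "\<exists>c. \<forall>i\<in>{k..m-l}. \<forall>t. poly (D i) t = (\<Sum>j=k..m-l. c i j * Bernstein m j t)"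
    by (auto simp: poly_inner_form)
  then have "\<forall>i\<in>{k..m-l}. \<forall>t. poly (D i) t
     = (\<Sum>j=k..m-l. dual_coeff \<alpha> \<beta> m k l i j * Bernstein m j t)"
    unfolding dual_coeff_def by (rule someI_ex)
  then show ?thesis
    using assms by (simp add: poly_eq_poly_eq_iff[symmetric] fun_eq_iff poly_inner_form)
qed

lemma jacobi_inner_Bernstein_dual:
  assumes "i \<in> {k..m-l}" "j \<in> {k..m-l}"
  shows "jacobi_inner \<alpha> \<beta> (Bernstein m j) (poly (D i)) = (if i = j then 1 else 0)"
  using constrained_dual_bernstein_is_dual_basis assms
  by (simp add: is_constrained_dual_basis_def jacobi_inner_commute[of _ _ "Bernstein m j"])

text \<open>An outer Bernstein polynomial and the combination of the inner ones with weights
  \<^const>\<open>K_coeff\<close> have the same inner products with all of the constrained space, in particular with the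
  dual polynomial, which picks out a single weight.\<close>
lemma jacobi_inner_Bernstein_dual_outer:
  assumes i: "i \<in> {k..m-l}" and j: "j \<le> m" "j \<notin> {k..m-l}"
  shows "jacobi_inner \<alpha> \<beta> (Bernstein m j) (poly (D i)) = K_coeff \<alpha> \<beta> m k l i j"
proof -
  let ?c = "dual_coeff \<alpha> \<beta> m k l i" and ?K = "\<lambda>q. K_coeff \<alpha> \<beta> m k l q j"
  have expand: "jacobi_inner \<alpha> \<beta> (Bernstein m q) (poly (D i))
     = (\<Sum>s=k..m-l. ?c s * jacobi_inner \<alpha> \<beta> (Bernstein m q) (Bernstein m s))" for q
    unfolding dual_coeff_expansion[OF i]
    by (rule jacobi_inner_inner_form_right) (intro continuous_intros)
  have "jacobi_inner \<alpha> \<beta> (Bernstein m j) (poly (D i))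
     = (\<Sum>s=k..m-l. ?c s * (\<Sum>q=k..m-l. ?K q * jacobi_inner \<alpha> \<beta> (Bernstein m q) (Bernstein m s)))"
    unfolding expand by (intro sum.cong refl) (simp add: jacobi_inner_Bernstein_outer[OF \<alpha> \<beta> kl _ j])
  also have "\<dots> = (\<Sum>q=k..m-l. ?K q * jacobi_inner \<alpha> \<beta> (Bernstein m q) (poly (D i)))"
    unfolding expand sum_distrib_left by (subst sum.swap) (simp add: mult_ac)
  also have "\<dots> = (\<Sum>q=k..m-l. if q = i then ?K q else 0)"
    by (intro sum.cong refl) (auto simp: jacobi_inner_Bernstein_dual[OF i])
  finally show ?thesis using i by simp
qed

section \<open>The best approximation\<close>

lemma orthogonal_residual_exists:
  assumes R: "continuous_on {0..1} R"
  shows "\<exists>P. admissible m k l R P \<and>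
    (\<forall>Q\<in>constrained_space m k l. jacobi_inner \<alpha> \<beta> (\<lambda>t. R t - poly P t) (poly Q) = 0)"
proof -
  obtain P0 where P0: "admissible m k l R P0" using admissible_exists[OF kl] by blast
  let ?f = "\<lambda>t. R t - poly P0 t"
  have f: "continuous_on {0..1} ?f" by (intro continuous_intros R)
  \<comment> \<open>The dual basis reads off the projection of the residual onto the constrained space.\<close>
  define S where "S = inner_form m k l (\<lambda>i. jacobi_inner \<alpha> \<beta> ?f (poly (D i)))"
  have S: "S \<in> constrained_space m k l"
    by (simp add: S_def constrained_space_eq_range[OF kl])
  let ?g = "\<lambda>t. R t - poly (P0 + S) t"
  have g: "continuous_on {0..1} ?g" by (intro continuous_intros R)
  have dual: "jacobi_inner \<alpha> \<beta> ?g (poly (D i)) = 0" if i: "i \<in> {k..m-l}" for i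
  proof -
    have "jacobi_inner \<alpha> \<beta> (poly S) (poly (D i))
       = (\<Sum>j=k..m-l. jacobi_inner \<alpha> \<beta> ?f (poly (D j)) * jacobi_inner \<alpha> \<beta> (Bernstein m j) (poly (D i)))"
      unfolding S_def by (rule jacobi_inner_inner_form) (intro continuous_intros)
    also have "\<dots> = (\<Sum>j=k..m-l. if j = i then jacobi_inner \<alpha> \<beta> ?f (poly (D j)) else 0)"
      by (intro sum.cong refl) (auto simp: jacobi_inner_Bernstein_dual[OF i])
    finally have "jacobi_inner \<alpha> \<beta> (poly S) (poly (D i)) = jacobi_inner \<alpha> \<beta> ?f (poly (D i))"
      using i by simp
    then show ?thesis
      using jacobi_inner_diff[OF \<alpha> \<beta> f, of "poly S" "poly (D i)"]
      by (simp add: continuous_intros diff_diff_eq)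
  qed
  have "jacobi_inner \<alpha> \<beta> ?g (poly Q) = 0" if Q: "Q \<in> constrained_space m k l" for Q
  proof -
    have "Q \<in> real_poly.span (D ` {k..m-l})"
      using constrained_dual_bernstein_is_dual_basis Q by (simp add: is_constrained_dual_basis_def)
    then obtain u where u: "Q = (\<Sum>v\<in>D ` {k..m-l}. smult (u v) v)"
      by (auto simp: real_poly.span_finite)
    have "poly Q = (\<lambda>t. \<Sum>v\<in>D ` {k..m-l}. u v * poly v t)"
      by (simp add: u fun_eq_iff poly_sum)
    then have "jacobi_inner \<alpha> \<beta> (poly Q) ?g
       = (\<Sum>v\<in>D ` {k..m-l}. u v * jacobi_inner \<alpha> \<beta> (poly v) ?g)"
      by (simp only:) (rule jacobi_inner_sum[OF \<alpha> \<beta>], (intro continuous_intros R | simp)+)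
    also have "\<dots> = 0"
    proof (intro sum.neutral ballI)
      fix v assume "v \<in> D ` {k..m-l}"
      then have "jacobi_inner \<alpha> \<beta> ?g (poly v) = 0" using dual by blast
      then show "u v * jacobi_inner \<alpha> \<beta> (poly v) ?g = 0"
        by (simp only: jacobi_inner_commute[of _ _ ?g] mult_zero_right)
    qed
    finally show ?thesis by (simp only: jacobi_inner_commute[of _ _ ?g])
  qed
  with admissible_add[OF P0 S] show ?thesis by blast
qed

lemma sq_error_Pythagoras:
  assumes R: "continuous_on {0..1} R"
    and orth: "\<forall>S\<in>constrained_space m k l. jacobi_inner \<alpha> \<beta> (\<lambda>t. R t - poly P t) (poly S) = 0"
    and PQ: "P - Q \<in> constrained_space m k l"
  shows "sq_error \<alpha> \<beta> R Q = sq_error \<alpha> \<beta> R P + jacobi_inner \<alpha> \<beta> (poly (P - Q)) (poly (P - Q))"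
proof -
  let ?f = "\<lambda>t. R t - poly P t" and ?g = "\<lambda>t. R t - poly Q t" and ?h = "poly (P - Q)"
  have cont: "continuous_on {0..1} ?f" "continuous_on {0..1} ?g" "continuous_on {0..1} ?h"
    by (intro continuous_intros R)+
  have "?h = (\<lambda>t. ?g t - ?f t)" by (simp add: fun_eq_iff)
  then have *: "jacobi_inner \<alpha> \<beta> ?h u = jacobi_inner \<alpha> \<beta> ?g u - jacobi_inner \<alpha> \<beta> ?f u"
    if "continuous_on {0..1} u" for u
    using jacobi_inner_diff[OF \<alpha> \<beta> cont(2,1) that] by simp
  have "jacobi_inner \<alpha> \<beta> ?f ?h = 0" using orth PQ by blast
  then show ?thesis
    unfolding sq_error_eq_jacobi_inner
    using *[OF cont(1)] *[OF cont(2)] *[OF cont(3)] jacobi_inner_commute[of \<alpha> \<beta> ?h ?f]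
      jacobi_inner_commute[of \<alpha> \<beta> ?h ?g] jacobi_inner_commute[of \<alpha> \<beta> ?f ?g]
    by linarith
qed

text \<open>An admissible polynomial with orthogonal residual exists, and by the theorem of Pythagoras any
  other admissible polynomial has a strictly larger error.\<close>
lemma is_best_approx_iff_orthogonal:
  assumes R: "continuous_on {0..1} R"
  shows "is_best_approx \<alpha> \<beta> m k l R P \<longleftrightarrow> admissible m k l R P \<and>
    (\<forall>Q\<in>constrained_space m k l. jacobi_inner \<alpha> \<beta> (\<lambda>t. R t - poly P t) (poly Q) = 0)"
    (is "_ \<longleftrightarrow> ?orth P")
proof
  assume P: "is_best_approx \<alpha> \<beta> m k l R P"
  obtain P' where P': "?orth P'" using orthogonal_residual_exists[OF R] by blast
  have "P' - P \<in> constrained_space m k l"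
    using P P' admissible_diff by (auto simp: is_best_approx_def)
  then have "sq_error \<alpha> \<beta> R P
     = sq_error \<alpha> \<beta> R P' + jacobi_inner \<alpha> \<beta> (poly (P' - P)) (poly (P' - P))"
    using sq_error_Pythagoras[OF R] P' by blast
  moreover have "sq_error \<alpha> \<beta> R P \<le> sq_error \<alpha> \<beta> R P'"
    using P P' by (auto simp: is_best_approx_def)
  ultimately have "jacobi_inner \<alpha> \<beta> (poly (P' - P)) (poly (P' - P)) = 0"
    using jacobi_inner_nonneg[of \<alpha> \<beta> "poly (P' - P)"] by linarith
  then have "P' = P" using jacobi_inner_definite[OF \<alpha> \<beta>] by fastforce
  then show "?orth P" using P' by simp
next
  assume P: "?orth P"
  have "sq_error \<alpha> \<beta> R P \<le> sq_error \<alpha> \<beta> R Q" if "admissible m k l R Q" for Q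
    using sq_error_Pythagoras[OF R, of P Q] P admissible_diff that
      jacobi_inner_nonneg[of \<alpha> \<beta> "poly (P - Q)"] by auto
  then show "is_best_approx \<alpha> \<beta> m k l R P" using P by (simp add: is_best_approx_def)
qed

lemma is_best_approx_ex1:
  assumes R: "continuous_on {0..1} R"
  shows "\<exists>!P. is_best_approx \<alpha> \<beta> m k l R P"
proof -
  obtain P where P: "is_best_approx \<alpha> \<beta> m k l R P"
    using orthogonal_residual_exists[OF R] is_best_approx_iff_orthogonal[OF R] by blast
  have "Q = P" if Q: "is_best_approx \<alpha> \<beta> m k l R Q" for Q
  proof -
    have "P - Q \<in> constrained_space m k l"
      using P Q admissible_diff by (auto simp: is_best_approx_def)
    then have "sq_error \<alpha> \<beta> R Q
       = sq_error \<alpha> \<beta> R P + jacobi_inner \<alpha> \<beta> (poly (P - Q)) (poly (P - Q))"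
      using sq_error_Pythagoras[OF R] P by (simp add: is_best_approx_iff_orthogonal[OF R])
    moreover have "sq_error \<alpha> \<beta> R Q = sq_error \<alpha> \<beta> R P"
      using P Q by (auto simp: is_best_approx_def intro!: order.antisym)
    ultimately show ?thesis using jacobi_inner_definite[OF \<alpha> \<beta>, of "P - Q"] by simp
  qed
  with P show ?thesis by blast
qed

text \<open>Pair the residual, which is orthogonal to the constrained space, with the \<^term>\<open>i\<close>-th dual
  polynomial.\<close>
lemma best_approx_inner_coeff:
  assumes R: "continuous_on {0..1} R" and best: "is_best_approx \<alpha> \<beta> m k l R (bernstein_form m p)"
    and i: "i \<in> {k..m-l}"
  shows "p i = jacobi_inner \<alpha> \<beta> R (poly (D i))
     - ((\<Sum>j<k. p j * K_coeff \<alpha> \<beta> m k l i j) + (\<Sum>j=m-l+1..m. p j * K_coeff \<alpha> \<beta> m k l i j))"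
proof -
  let ?J = "\<lambda>j. p j * jacobi_inner \<alpha> \<beta> (Bernstein m j) (poly (D i))"
  have "D i \<in> constrained_space m k l"
    by (simp add: dual_coeff_expansion[OF i] constrained_space_eq_range[OF kl])
  then have "jacobi_inner \<alpha> \<beta> (\<lambda>t. R t - poly (bernstein_form m p) t) (poly (D i)) = 0"
    using best is_best_approx_iff_orthogonal[OF R] by blast
  then have "jacobi_inner \<alpha> \<beta> R (poly (D i)) = jacobi_inner \<alpha> \<beta> (poly (bernstein_form m p)) (poly (D i))"
    using jacobi_inner_diff[OF \<alpha> \<beta> R, of "poly (bernstein_form m p)" "poly (D i)"]
    by (simp add: continuous_on_polynomial)
  also have "\<dots> = (\<Sum>j\<le>m. ?J j)"
    unfolding poly_bernstein_form[abs_def]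
    by (rule jacobi_inner_sum[OF \<alpha> \<beta>]) (intro continuous_intros | simp)+
  also have "{..m} = {..<k} \<union> {k..m-l} \<union> {m-l+1..m}" using kl by auto
  also have "(\<Sum>j\<in>{..<k} \<union> {k..m-l} \<union> {m-l+1..m}. ?J j)
     = (\<Sum>j<k. ?J j) + (\<Sum>j=k..m-l. ?J j) + (\<Sum>j=m-l+1..m. ?J j)"
    using kl by (subst sum.union_disjoint; (subst sum.union_disjoint)?) auto
  also have "(\<Sum>j=k..m-l. ?J j) = (\<Sum>j=k..m-l. if j = i then p j else 0)"
    by (intro sum.cong refl) (auto simp: jacobi_inner_Bernstein_dual[OF i])
  also have "\<dots> = p i" using i by simp
  also have "(\<Sum>j<k. ?J j) = (\<Sum>j<k. p j * K_coeff \<alpha> \<beta> m k l i j)"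
    by (intro sum.cong refl) (use kl in \<open>auto simp: jacobi_inner_Bernstein_dual_outer[OF i]\<close>)
  also have "(\<Sum>j=m-l+1..m. ?J j) = (\<Sum>j=m-l+1..m. p j * K_coeff \<alpha> \<beta> m k l i j)"
    by (intro sum.cong refl) (use kl in \<open>auto simp: jacobi_inner_Bernstein_dual_outer[OF i]\<close>)
  finally show ?thesis by simp
qed

end

section \<open>Inner products with the rational function\<close>

lemma jacobi_inner_rational_bezier_Bernstein:
  assumes \<omega>: "\<And>i. i \<le> n \<Longrightarrow> \<omega> i > 0" and "j \<le> m"
  shows "jacobi_inner \<alpha> \<beta> (rational_bezier n \<omega> r) (Bernstein m j)
     = (\<Sum>h\<le>n. real (n choose h) * \<omega> h * r h
          * (real (m choose j) / real ((n + m) choose (j + h)) * I_int \<alpha> \<beta> n m \<omega> (j + h)))"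
proof -
  let ?W = "weight_fun n \<omega>"
  let ?c = "\<lambda>h. \<omega> h * r h * (real (n choose h) * real (m choose j) / real ((n + m) choose (j + h)))"
  have cont: "continuous_on {0..1} (\<lambda>t. Bernstein (n + m) q t / ?W t)" for q
  proof -
    have "\<forall>t\<in>{0..1}. ?W t \<noteq> 0" using weight_fun_pos[OF \<omega>] by fastforce
    then show ?thesis
      unfolding weight_fun_conv_bernstein_form by (intro continuous_intros)
  qed
  have "rational_bezier n \<omega> r t * Bernstein m j t
    = (\<Sum>h\<le>n. ?c h * (Bernstein (n + m) (j + h) t / ?W t))" for t
  proof -
    have "rational_bezier n \<omega> r t * Bernstein m j t
      = (\<Sum>h\<le>n. \<omega> h * r h * (Bernstein n h t * Bernstein m j t) / ?W t)"
      by (simp add: rational_bezier_def sum_distrib_right mult.assoc flip: sum_divide_distrib)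
    also have "\<dots> = (\<Sum>h\<le>n. ?c h * (Bernstein (n + m) (j + h) t / ?W t))"
      by (intro sum.cong refl) (simp add: Bernstein_mult assms(2))
    finally show ?thesis .
  qed
  then have "jacobi_inner \<alpha> \<beta> (rational_bezier n \<omega> r) (Bernstein m j)
     = jacobi_inner \<alpha> \<beta> (\<lambda>t. \<Sum>h\<le>n. ?c h * (Bernstein (n + m) (j + h) t / ?W t)) (\<lambda>_. 1)"
    by (simp add: jacobi_inner_def mult.assoc)
  also have "\<dots> = (\<Sum>h\<le>n. ?c h * jacobi_inner \<alpha> \<beta> (\<lambda>t. Bernstein (n + m) (j + h) t / ?W t) (\<lambda>_. 1))"
    by (rule jacobi_inner_sum[OF \<alpha> \<beta>]) (simp_all add: cont)
  finally show ?thesis by (simp add: jacobi_inner_def I_int_def mult_ac)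
qed

end

theorem theorem3p1:
  fixes n m k l :: nat and \<alpha> \<beta> :: real and r \<omega> :: "nat \<Rightarrow> real"
  assumes "k + l \<le> m"
    and "\<alpha> > -1" and "\<beta> > -1"
    and "\<And>i. i \<le> n \<Longrightarrow> \<omega> i > 0"
  shows "(\<exists>!P. is_best_approx \<alpha> \<beta> m k l (rational_bezier n \<omega> r) P) \<and>
    (\<forall>P. is_best_approx \<alpha> \<beta> m k l (rational_bezier n \<omega> r) P \<longrightarrow>
      (\<exists>p. \<forall>t. poly P t = (\<Sum>i\<le>m. p i * Bernstein m i t)) \<and>
      (\<forall>p. (\<forall>t. poly P t = (\<Sum>i\<le>m. p i * Bernstein m i t)) \<longrightarrow>
        (\<forall>i<k. p i = fact (m - i) / fact m * rho0 n \<omega> r i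
                 - (\<Sum>j<i. (-1) ^ (i + j) * real (i choose j) * p j)) \<and>
        (\<forall>i<l. p (m - i) = (-1) ^ i * (fact (m - i) / fact m) * rho1 n \<omega> r i
                 - (\<Sum>j=1..i. (-1) ^ j * real (i choose j) * p (m - i + j))) \<and>
        (\<forall>i\<in>{k..m-l}. p i =
           (\<Sum>h\<le>n. real (n choose h) * \<omega> h * r h *
              (\<Sum>j=k..m-l. real (m choose j) / real ((n + m) choose (j + h))
                 * dual_coeff \<alpha> \<beta> m k l i j * I_int \<alpha> \<beta> n m \<omega> (j + h)))
           - ((\<Sum>j<k. p j * K_coeff \<alpha> \<beta> m k l i j)
              + (\<Sum>j=m-l+1..m. p j * K_coeff \<alpha> \<beta> m k l i j)))))"
proof (rule conjI)
  let ?R = "rational_bezier n \<omega> r"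
  have R: "continuous_on {0..1} ?R" using assms(4) by (rule continuous_on_rational_bezier)
  show "\<exists>!P. is_best_approx \<alpha> \<beta> m k l ?R P"
    using is_best_approx_ex1[OF assms(2,3,1) R] .
  show "\<forall>P. is_best_approx \<alpha> \<beta> m k l ?R P \<longrightarrow>
      (\<exists>p. \<forall>t. poly P t = (\<Sum>i\<le>m. p i * Bernstein m i t)) \<and>
      (\<forall>p. (\<forall>t. poly P t = (\<Sum>i\<le>m. p i * Bernstein m i t)) \<longrightarrow>
        (\<forall>i<k. p i = fact (m - i) / fact m * rho0 n \<omega> r i
                 - (\<Sum>j<i. (-1) ^ (i + j) * real (i choose j) * p j)) \<and>
        (\<forall>i<l. p (m - i) = (-1) ^ i * (fact (m - i) / fact m) * rho1 n \<omega> r i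
                 - (\<Sum>j=1..i. (-1) ^ j * real (i choose j) * p (m - i + j))) \<and>
        (\<forall>i\<in>{k..m-l}. p i =
           (\<Sum>h\<le>n. real (n choose h) * \<omega> h * r h *
              (\<Sum>j=k..m-l. real (m choose j) / real ((n + m) choose (j + h))
                 * dual_coeff \<alpha> \<beta> m k l i j * I_int \<alpha> \<beta> n m \<omega> (j + h)))
           - ((\<Sum>j<k. p j * K_coeff \<alpha> \<beta> m k l i j)
              + (\<Sum>j=m-l+1..m. p j * K_coeff \<alpha> \<beta> m k l i j))))"
  proof (intro allI impI conjI ballI)
    fix P assume best: "is_best_approx \<alpha> \<beta> m k l ?R P"
    then have adm: "admissible m k l ?R P" by (simp add: is_best_approx_def)
    then show "\<exists>p. \<forall>t. poly P t = (\<Sum>i\<le>m. p i * Bernstein m i t)"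
      using bernstein_form_exists[of P m] by (auto simp: admissible_def poly_bernstein_form)
    fix p assume "\<forall>t. poly P t = (\<Sum>i\<le>m. p i * Bernstein m i t)"
    then have P: "P = bernstein_form m p"
      by (simp add: poly_eq_poly_eq_iff[symmetric] fun_eq_iff poly_bernstein_form)
    note boundary = adm[unfolded P admissible_bernstein_form_iff[OF assms(1)]]
    show "p i = fact (m - i) / fact m * rho0 n \<omega> r i
                 - (\<Sum>j<i. (-1) ^ (i + j) * real (i choose j) * p j)" if "i < k" for i
    proof -
      have "fwd_diff i p 0 = fact (m - i) / fact m * rho0 n \<omega> r i"
        using boundary that assms(4)[of 0] rho0_eq_deriv[of \<omega> n r i] by simp
      then show ?thesis unfolding fwd_diff_0_split by linarith
    qed
    show "p (m - i) = (-1) ^ i * (fact (m - i) / fact m) * rho1 n \<omega> r i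
                 - (\<Sum>j=1..i. (-1) ^ j * real (i choose j) * p (m - i + j))" if "i < l" for i
    proof -
      have "(\<Sum>j<i. (-1) ^ (i + j) * real (i choose j) * p (m - j))
        = (\<Sum>j=1..i. (-1) ^ j * real (i choose j) * p (m - i + j))"
      proof (rule sum.reindex_bij_witness[of _ "\<lambda>j. i - j" "\<lambda>j. i - j"])
        fix j assume "j \<in> {..<i}"
        then have j: "j < i" by simp
        have "(-1) ^ (i - j) = ((-1) ^ (i + j) :: real)"
          using j by (auto simp: minus_one_power_iff)
        moreover have "m - i + (i - j) = m - j" using j that assms(1) by simp
        ultimately show "(-1) ^ (i - j) * real (i choose (i - j)) * p (m - i + (i - j))
           = (-1) ^ (i + j) * real (i choose j) * p (m - j)"
          using j by (simp add: binomial_symmetric[of j i])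
      qed auto
      moreover have "fwd_diff i (\<lambda>j. p (m - j)) 0 = (-1) ^ i * (fact (m - i) / fact m) * rho1 n \<omega> r i"
        using boundary that assms(4)[of n] rho1_eq_deriv[of \<omega> n r i] by simp
      ultimately show ?thesis unfolding fwd_diff_0_split by linarith
    qed
    fix i assume i: "i \<in> {k..m-l}"
    let ?c = "dual_coeff \<alpha> \<beta> m k l i"
    have "jacobi_inner \<alpha> \<beta> ?R (poly (constrained_dual_bernstein \<alpha> \<beta> m k l i))
      = (\<Sum>j=k..m-l. ?c j * jacobi_inner \<alpha> \<beta> ?R (Bernstein m j))"
      using dual_coeff_expansion[OF assms(2,3,1) i] jacobi_inner_inner_form_right[OF assms(2,3) R] by simp
    also have "\<dots> = (\<Sum>j=k..m-l. ?c j * (\<Sum>h\<le>n. real (n choose h) * \<omega> h * r h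
          * (real (m choose j) / real ((n + m) choose (j + h)) * I_int \<alpha> \<beta> n m \<omega> (j + h))))"
      by (intro sum.cong refl) (auto simp: jacobi_inner_rational_bezier_Bernstein[OF assms(2,3,4)])
    also have "\<dots> = (\<Sum>h\<le>n. real (n choose h) * \<omega> h * r h *
              (\<Sum>j=k..m-l. real (m choose j) / real ((n + m) choose (j + h))
                 * ?c j * I_int \<alpha> \<beta> n m \<omega> (j + h)))"
      unfolding sum_distrib_left by (subst sum.swap) (simp add: mult_ac)
    finally show "p i =
           (\<Sum>h\<le>n. real (n choose h) * \<omega> h * r h *
              (\<Sum>j=k..m-l. real (m choose j) / real ((n + m) choose (j + h))
                 * dual_coeff \<alpha> \<beta> m k l i j * I_int \<alpha> \<beta> n m \<omega> (j + h)))
           - ((\<Sum>j<k. p j * K_coeff \<alpha> \<beta> m k l i j)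
              + (\<Sum>j=m-l+1..m. p j * K_coeff \<alpha> \<beta> m k l i j))"
      using best_approx_inner_coeff[OF assms(2,3,1) R best[unfolded P] i] by simp
  qed
qed

end
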